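(* For all $\mu,\nu\in\mathcal{M}$ one has $W_1^{1,1}(\mu,\nu)=d(\mu,\nu)$, that is, $$\inf_{\tilde\mu,\tilde\nu\in\mathcal{M},\ |\tilde\mu|=|\tilde\nu|}\Big(|\mu-\tilde\mu|+|\nu-\tilde\nu|+W_1(\tilde\mu,\tilde\nu)\Big)=\sup\Big\{\int_{\mathbb{R}^d} f\,d(\mu-\nu)\ \Big|\ f\in C^0_c(\mathbb{R}^d,\mathbb{R}),\ \|f\|_\infty\le 1,\ \|f\|_{Lip}\le 1\Big\}.$$
   Context: $\mathcal{M}$ is the set of positive Borel regular measures on $\mathbb{R}^d$ with finite mass. For $\mu\in\mathcal{M}$, $|\mu|:=\mu(\mathbb{R}^d)$; for a finite signed Borel measure $\sigma=\sigma^+-\sigma^-$ (Jordan decomposition), $|\sigma|:=|\sigma^+|+|\sigma^-|$ (total variation). $\|f\|_{Lip}$ denotes the best Lipschitz constant of $f$, and $C^0_c$ denotes continuous functions with compact support. For $\mu,\nu\in\mathcal{M}$ with the same mass $|\mu|=|\nu|>0$, $\Pi(\mu,\nu)$ is the set of probability measures $\pi$ on $\mathbb{R}^d\times\mathbb{R}^d$ such that $|\mu|\pi$ has first marginal $\mu$ and second marginal $\nu$. The Wasserstein distance of order 1 is $W_1(\mu,\nu):=|\mu|\min_{\pi\in\Pi(\mu,\nu)}\int|x-y|\,d\pi(x,y)\in[0,+\infty]$, with $W_1(0,0)=0$. The generalized Wasserstein distance is $W_1^{1,1}(\mu,\nu):=\inf_{\tilde\mu,\tilde\nu\in\mathcal{M},\,|\tilde\mu|=|\tilde\nu|}\big(|\mu-\tilde\mu|+|\nu-\tilde\nu|+W_1(\tilde\mu,\tilde\nu)\big)$.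 The flat metric is $d(\mu,\nu):=\sup\{\int f\,d(\mu-\nu)\ |\ f\in C^0_c(\mathbb{R}^d,\mathbb{R}),\ \|f\|_\infty\le1,\ \|f\|_{Lip}\le1\}$. *)

theory Defs
  imports "HOL-Probability.Probability"
begin

text \<open>The two regularity clauses are automatic for finite Borel measures on a Euclidean
  space, see \<open>fin_meas_iff\<close> below.\<close>

definition fin_meas :: "'a::euclidean_space measure set" where
  "fin_meas = {M. sets M = sets borel \<and> finite_measure M \<and>
     (\<forall>B\<in>sets borel. emeasure M B = (SUP K\<in>{K. K \<subseteq> B \<and> compact K}. emeasure M K)) \<and>
     (\<forall>B\<in>sets borel. emeasure M B = (INF U\<in>{U. B \<subseteq> U \<and> open U}. emeasure M U))}"

definition mass :: "'a::euclidean_space measure \<Rightarrow> real" where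
  "mass M = measure M UNIV"

text \<open>Finite signed Borel measures are represented by their real-valued set functions.
  Only the values on Borel sets are relevant.\<close>

definition meas_diff ::
    "'a::euclidean_space measure \<Rightarrow> 'a measure \<Rightarrow> 'a set \<Rightarrow> real" where
  "meas_diff M N = (\<lambda>B. measure M B - measure N B)"

definition jordan_decomp ::
    "('a::euclidean_space set \<Rightarrow> real) \<Rightarrow> 'a measure \<Rightarrow> 'a measure \<Rightarrow> bool" where
  "jordan_decomp \<sigma> P Q \<longleftrightarrow> P \<in> fin_meas \<and> Q \<in> fin_meas \<and>
     (\<exists>A\<in>sets borel. emeasure P (- A) = 0 \<and> emeasure Q A = 0) \<and>
     (\<forall>B\<in>sets borel. \<sigma> B = measure P B - measure Q B)"

text \<open>Well-defined on differences of finite measures, by \<open>jordan_decomp_exists\<close> and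
  \<open>total_variation_eq\<close> below.\<close>

definition total_variation :: "('a::euclidean_space set \<Rightarrow> real) \<Rightarrow> real" where
  "total_variation \<sigma> = (THE v. \<exists>P Q. jordan_decomp \<sigma> P Q \<and> v = mass P + mass Q)"

definition couplings ::
    "'a::euclidean_space measure \<Rightarrow> 'a measure \<Rightarrow> ('a \<times> 'a) measure set" where
  "couplings M N = {\<pi>. sets \<pi> = sets borel \<and> prob_space \<pi> \<and>
     distr (scale_measure (ennreal (mass M)) \<pi>) borel fst = M \<and>
     distr (scale_measure (ennreal (mass M)) \<pi>) borel snd = N}"

text \<open>Meaningful only for measures of equal mass; the first case is \<open>W\<^sub>1(0,0) = 0\<close>.\<close>

definition wasserstein1 ::
    "'a::euclidean_space measure \<Rightarrow> 'a measure \<Rightarrow> ereal" where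
  "wasserstein1 M N =
     (if mass M = 0 then 0
      else ereal (mass M) *
        (INF \<pi>\<in>couplings M N. enn2ereal (\<integral>\<^sup>+ (x, y). ennreal (norm (x - y)) \<partial>\<pi>)))"

definition gen_wasserstein ::
    "'a::euclidean_space measure \<Rightarrow> 'a measure \<Rightarrow> ereal" where
  "gen_wasserstein M N =
     (INF (M', N')\<in>{(M', N'). M' \<in> fin_meas \<and> N' \<in> fin_meas \<and> mass M' = mass N'}.
        ereal (total_variation (meas_diff M M')) + ereal (total_variation (meas_diff N N'))
          + wasserstein1 M' N')"

definition sup_norm :: "('a \<Rightarrow> real) \<Rightarrow> ereal" where
  "sup_norm f = (SUP x. ereal \<bar>f x\<bar>)"

definition lip_const :: "('a::metric_space \<Rightarrow> real) \<Rightarrow> ereal" where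
  "lip_const f = (INF L\<in>{L. L-lipschitz_on UNIV f}. ereal L)"

definition flat_dist ::
    "'a::euclidean_space measure \<Rightarrow> 'a measure \<Rightarrow> ereal" where
  "flat_dist M N =
     (SUP f\<in>{f. continuous_on UNIV f \<and> compact (closure {x. f x \<noteq> 0}) \<and>
               sup_norm f \<le> 1 \<and> lip_const f \<le> 1}.
        ereal ((\<integral>x. f x \<partial>M) - (\<integral>x. f x \<partial>N)))"

lemma fin_meas_iff: "M \<in> fin_meas \<longleftrightarrow> sets M = sets borel \<and> finite_measure M"
proof
  assume "M \<in> fin_meas"
  then show "sets M = sets borel \<and> finite_measure M"
    unfolding fin_meas_def by blast
next
  assume M: "sets M = sets borel \<and> finite_measure M"
  then have "emeasure M (space M) \<noteq> \<infinity>"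
    by (simp add: finite_measure.finite_emeasure_space)
  then show "M \<in> fin_meas"
    unfolding fin_meas_def using M inner_regular[of M] outer_regular[of M] by blast
qed

lemma sup_norm_le_1_iff: "sup_norm f \<le> 1 \<longleftrightarrow> (\<forall>x. \<bar>f x\<bar> \<le> 1)"
  unfolding sup_norm_def by (simp add: SUP_le_iff)

lemma lip_const_le_1_iff: "lip_const f \<le> 1 \<longleftrightarrow> 1-lipschitz_on UNIV f"
proof
  assume "1-lipschitz_on UNIV f"
  then show "lip_const f \<le> 1"
    unfolding lip_const_def by (intro INF_lower2[of 1]) auto
next
  assume le: "lip_const f \<le> 1"
  have "dist (f x) (f y) \<le> dist x y" for x y
  proof (rule field_le_epsilon)
    fix e :: real assume e: "0 < e"
    define r where "r = 1 + e / (dist x y + 1)"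
    have "r > 1" unfolding r_def using e by (simp add: add_nonneg_pos)
    then have "(1::ereal) < ereal r" by simp
    with le have "lip_const f < ereal r" by (rule le_less_trans)
    then obtain L where L: "L-lipschitz_on UNIV f" "L < r"
      unfolding lip_const_def by (auto simp: INF_less_iff)
    have "dist (f x) (f y) \<le> L * dist x y"
      using lipschitz_onD[OF L(1)] by simp
    also have "\<dots> \<le> r * dist x y"
      using L(2) by (intro mult_right_mono) auto
    also have "\<dots> = dist x y + e * (dist x y / (dist x y + 1))"
      unfolding r_def by (simp add: algebra_simps)
    also have "\<dots> \<le> dist x y + e"
    proof -
      have "dist x y / (dist x y + 1) \<le> 1"
        by (simp add: divide_le_eq_1 add_nonneg_pos)
      then show ?thesis using mult_left_le[of _ e] e by (smt (verit))
    qed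
    finally show "dist (f x) (f y) \<le> dist x y + e" .
  qed
  then show "1-lipschitz_on UNIV f" by (auto simp: lipschitz_on_def)
qed

lemma diff_part:
  fixes M N :: "'a::euclidean_space measure"
  assumes M: "M \<in> fin_meas" and N: "N \<in> fin_meas" and Y: "Y \<in> sets borel"
    and le: "\<And>X. X \<in> sets borel \<Longrightarrow> X \<subseteq> Y \<Longrightarrow> emeasure N X \<le> emeasure M X"
  obtains P where "P \<in> fin_meas" "emeasure P (- Y) = 0"
    "\<And>B. B \<in> sets borel \<Longrightarrow> measure P B = measure M (Y \<inter> B) - measure N (Y \<inter> B)"
proof -
  interpret M: finite_measure M using M by (simp add: fin_meas_iff)
  interpret N: finite_measure N using N by (simp add: fin_meas_iff)
  have s: "sets M = sets borel" "sets N = sets borel" using M N by (auto simp: fin_meas_iff)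
  define MY where "MY = density M (indicator Y)"
  define NY where "NY = density N (indicator Y)"
  have eM: "emeasure MY B = emeasure M (Y \<inter> B)" if "B \<in> sets borel" for B
    unfolding MY_def using that Y s by (simp add: emeasure_restricted)
  have eN: "emeasure NY B = emeasure N (Y \<inter> B)" if "B \<in> sets borel" for B
    unfolding NY_def using that Y s by (simp add: emeasure_restricted)
  have sY: "sets MY = sets borel" "sets NY = sets borel"
    unfolding MY_def NY_def using s by auto
  have sp: "space MY = UNIV" "space NY = UNIV"
    using sY[THEN sets_eq_imp_space_eq] by auto
  have f: "finite_measure MY" "finite_measure NY"
    using eM[of UNIV] eN[of UNIV] sp by (auto intro!: finite_measureI)
  define P where "P = diff_measure MY NY"
  have eP: "emeasure P B = emeasure M (Y \<inter> B) - emeasure N (Y \<inter> B)" if "B \<in> sets borel" for B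
    unfolding P_def using that f sY Y le
    by (subst emeasure_diff_measure) (auto simp: eM eN)
  have sP: "sets P = sets borel" unfolding P_def using sY by simp
  have "space P = UNIV" using sets_eq_imp_space_eq[OF sP] by simp
  then have "finite_measure P"
    using eP[of UNIV] M.emeasure_finite by (auto intro!: finite_measureI simp: ennreal_minus_eq_top)
  then have "P \<in> fin_meas" using sP by (simp add: fin_meas_iff)
  moreover have "emeasure P (- Y) = 0" using eP[of "- Y"] Y by auto
  moreover have "measure P B = measure M (Y \<inter> B) - measure N (Y \<inter> B)" if B: "B \<in> sets borel" for B
  proof -
    have YB: "Y \<inter> B \<in> sets borel" using Y B by auto
    have "measure N (Y \<inter> B) \<le> measure M (Y \<inter> B)"
      using le[OF YB] by (simp add: M.emeasure_eq_measure N.emeasure_eq_measure)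
    then show ?thesis
      using eP[OF B]
      by (simp add: measure_def[of P] M.emeasure_eq_measure N.emeasure_eq_measure ennreal_minus)
  qed
  ultimately show thesis by (rule that)
qed

lemma jordan_decomp_exists:
  fixes M N :: "'a::euclidean_space measure"
  assumes M: "M \<in> fin_meas" and N: "N \<in> fin_meas"
  shows "\<exists>P Q. jordan_decomp (meas_diff M N) P Q"
proof -
  interpret M: finite_measure M using M by (simp add: fin_meas_iff)
  interpret N: finite_measure N using N by (simp add: fin_meas_iff)
  have s: "sets M = sets borel" "sets N = sets borel" using M N by (auto simp: fin_meas_iff)
  obtain Y where Y: "Y \<in> sets borel"
    and 1: "\<And>X. X \<in> sets borel \<Longrightarrow> X \<subseteq> Y \<Longrightarrow> emeasure N X \<le> emeasure M X"
    and 2: "\<And>X. X \<in> sets borel \<Longrightarrow> X \<inter> Y = {} \<Longrightarrow> emeasure M X \<le> emeasure N X"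
    using finite_unsigned_Hahn_decomposition[of M N] s M.finite_measure_axioms
      N.finite_measure_axioms by auto
  obtain P where P: "P \<in> fin_meas" "emeasure P (- Y) = 0"
    "\<And>B. B \<in> sets borel \<Longrightarrow> measure P B = measure M (Y \<inter> B) - measure N (Y \<inter> B)"
    using diff_part[OF M N Y 1] by blast
  have "- Y \<in> sets borel" using Y by auto
  then obtain Q where Q: "Q \<in> fin_meas" "emeasure Q (- (- Y)) = 0"
    "\<And>B. B \<in> sets borel \<Longrightarrow> measure Q B = measure N (- Y \<inter> B) - measure M (- Y \<inter> B)"
    using diff_part[OF N M, of "- Y"] 2 by blast
  have split: "measure K B = measure K (Y \<inter> B) + measure K (- Y \<inter> B)"
    if "K \<in> fin_meas" "B \<in> sets borel" for K :: "'a measure" and B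
  proof -
    interpret K: finite_measure K using that by (simp add: fin_meas_iff)
    have "measure K ((Y \<inter> B) \<union> (- Y \<inter> B)) = measure K (Y \<inter> B) + measure K (- Y \<inter> B)"
      using that Y by (intro K.finite_measure_Union) (auto simp: fin_meas_iff)
    moreover have "(Y \<inter> B) \<union> (- Y \<inter> B) = B" by auto
    ultimately show ?thesis by simp
  qed
  have "measure M B - measure N B = measure P B - measure Q B" if B: "B \<in> sets borel" for B
    using P(3)[OF B] Q(3)[OF B] split[OF M B] split[OF N B] by linarith
  moreover have "\<exists>A\<in>sets borel. emeasure P (- A) = 0 \<and> emeasure Q A = 0"
    using P(2) Q(2) Y by (intro bexI[of _ Y]) auto
  ultimately have "jordan_decomp (meas_diff M N) P Q"
    unfolding jordan_decomp_def meas_diff_def using P(1) Q(1) by blast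
  then show ?thesis by blast
qed

lemma jordan_decomp_mass:
  assumes 1: "jordan_decomp \<sigma> P Q" and 2: "jordan_decomp \<sigma> P' Q'"
  shows "mass P = mass P'" "mass Q = mass Q'"
proof -
  have *: "mass P = \<sigma> (A \<inter> A')" "mass Q = - \<sigma> (- A \<inter> - A')"
    if P: "P \<in> fin_meas" and Q: "Q \<in> fin_meas" and P': "P' \<in> fin_meas" and Q': "Q' \<in> fin_meas"
      and A: "A \<in> sets borel" "emeasure P (- A) = 0" "emeasure Q A = 0"
      and A': "A' \<in> sets borel" "emeasure P' (- A') = 0" "emeasure Q' A' = 0"
      and e: "\<forall>B\<in>sets borel. \<sigma> B = measure P B - measure Q B"
      and e': "\<forall>B\<in>sets borel. \<sigma> B = measure P' B - measure Q' B"
    for P Q P' Q' A A'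
  proof -
    have null: "measure K B = 0"
      if "K \<in> fin_meas" "C \<in> sets borel" "emeasure K C = 0" "B \<subseteq> C" for K and B C :: "'a set"
      using emeasure_mono[of B C K] that by (simp add: fin_meas_iff measure_def)
    have cA: "- A \<in> sets borel" "- A' \<in> sets borel" using A(1) A'(1) by auto
    have split: "measure K UNIV = measure K (A \<inter> A') + measure K (A \<inter> - A') +
        measure K (- A \<inter> A') + measure K (- A \<inter> - A')" if "K \<in> fin_meas" for K
    proof -
      interpret K: finite_measure K using that by (simp add: fin_meas_iff)
      have un: "measure K (B \<union> C) = measure K B + measure K C"
        if "B \<in> sets borel" "C \<in> sets borel" "B \<inter> C = {}" for B C
        using that \<open>K \<in> fin_meas\<close> by (intro K.finite_measure_Union) (auto simp: fin_meas_iff)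
      have "measure K (A \<union> - A) = measure K A + measure K (- A)"
        using A(1) cA by (intro un) auto
      moreover have "measure K ((A \<inter> A') \<union> (A \<inter> - A')) = measure K (A \<inter> A') + measure K (A \<inter> - A')"
        using A(1) A'(1) cA by (intro un) auto
      moreover have "measure K ((- A \<inter> A') \<union> (- A \<inter> - A')) =
          measure K (- A \<inter> A') + measure K (- A \<inter> - A')"
        using A(1) A'(1) cA by (intro un) auto
      moreover have "(A \<inter> A') \<union> (A \<inter> - A') = A" "(- A \<inter> A') \<union> (- A \<inter> - A') = - A" by auto
      ultimately show ?thesis by simp
    qed
    have b: "A \<inter> A' \<in> sets borel" "A \<inter> - A' \<in> sets borel" "- A \<inter> A' \<in> sets borel"
      "- A \<inter> - A' \<in> sets borel" using A(1) A'(1) cA by auto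
    have zP: "measure P (- A \<inter> A') = 0" "measure P (- A \<inter> - A') = 0"
      using null[OF P cA(1) A(2)] by auto
    have zQ: "measure Q (A \<inter> A') = 0" "measure Q (A \<inter> - A') = 0"
      using null[OF Q A(1) A(3)] by auto
    have zP': "measure P' (A \<inter> - A') = 0" using null[OF P' cA(2) A'(2)] by auto
    have zQ': "measure Q' (- A \<inter> A') = 0" using null[OF Q' A'(1) A'(3)] by auto
    have "measure P (A \<inter> - A') \<le> 0"
      using bspec[OF e b(2)] bspec[OF e' b(2)] zQ zP' measure_nonneg[of Q' "A \<inter> - A'"] by linarith
    then have zP2: "measure P (A \<inter> - A') = 0" by (simp add: measure_le_0_iff)
    have "measure Q (- A \<inter> A') \<le> 0"
      using bspec[OF e b(3)] bspec[OF e' b(3)] zP zQ' measure_nonneg[of P' "- A \<inter> A'"] by linarith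
    then have zQ2: "measure Q (- A \<inter> A') = 0" by (simp add: measure_le_0_iff)
    show "mass P = \<sigma> (A \<inter> A')" "mass Q = - \<sigma> (- A \<inter> - A')"
      unfolding mass_def using split[OF P] split[OF Q] zP zQ zP2 zQ2 bspec[OF e b(1)] bspec[OF e b(4)] by auto
  qed
  obtain A where A: "A \<in> sets borel" "emeasure P (- A) = 0" "emeasure Q A = 0"
    using 1 unfolding jordan_decomp_def by blast
  obtain A' where A': "A' \<in> sets borel" "emeasure P' (- A') = 0" "emeasure Q' A' = 0"
    using 2 unfolding jordan_decomp_def by blast
  have J: "P \<in> fin_meas" "Q \<in> fin_meas" "P' \<in> fin_meas" "Q' \<in> fin_meas"
    using 1 2 unfolding jordan_decomp_def by blast+
  have e: "\<forall>B\<in>sets borel. \<sigma> B = measure P B - measure Q B"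
    using 1 unfolding jordan_decomp_def by blast
  have e': "\<forall>B\<in>sets borel. \<sigma> B = measure P' B - measure Q' B"
    using 2 unfolding jordan_decomp_def by blast
  note a = *[OF J A A' e e'] and b = *[OF J(3,4,1,2) A' A e' e]
  show "mass P = mass P'" using a(1) b(1) by (simp add: Int_commute)
  show "mass Q = mass Q'" using a(2) b(2) by (simp add: Int_commute)
qed

lemma total_variation_eq:
  assumes "jordan_decomp \<sigma> P Q"
  shows "total_variation \<sigma> = mass P + mass Q"
  unfolding total_variation_def
proof (rule the_equality)
  show "\<exists>P' Q'. jordan_decomp \<sigma> P' Q' \<and> mass P + mass Q = mass P' + mass Q'"
    using assms by blast
next
  fix v assume "\<exists>P Q. jordan_decomp \<sigma> P Q \<and> v = mass P + mass Q"
  then obtain P' Q' where "jordan_decomp \<sigma> P' Q'" "v = mass P' + mass Q'" by blast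
  then show "v = mass P + mass Q"
    using jordan_decomp_mass[OF assms, of P' Q'] by simp
qed

end

theory Submission
  imports Defs
begin

text \<open>
  A test function cannot gain more than the total variation when the measures are altered, nor
  more than the transport cost when mass is moved, so the flat metric is the smaller quantity.

  For the converse, round points by a measurable map \<open>T\<close> of finite range that moves the points of a
  set \<open>K\<close> of almost full measure by at most \<open>\<epsilon>\<close>. On the fibres of \<open>T\<close> the problem is finite: the
  optimal value of the unbalanced transport problem is a sublinear function of the pair of weight
  vectors, and a supporting linear functional (finite-dimensional Hahn--Banach) is a pair of
  potentials \<open>f, g\<close> with values in \<open>[-1, 1]\<close> and \<open>f i + g j \<le> c i j\<close>. The \<open>c\<close>-transform of \<open>g\<close>,
  cut off far away, is an admissible test function dominating \<open>f\<close> and almost dominated by \<open>-g\<close>,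
  while a nearly optimal plan \<open>p\<close> lifts to a density with respect to \<open>\<mu> \<Otimes> \<nu>\<close> that is constant on
  products of fibres. No tightness or compactness is needed, since only the infimum matters.
\<close>

section \<open>Duality for finite unbalanced transport\<close>

text \<open>Homogeneity is asked as an inequality for \<open>t > 0\<close>, which is the form an
  infimum delivers; applying it to \<open>inverse t\<close> yields the reverse inequality. Vectors
  are functions on an arbitrary type, and finiteness enters later through the coordinates to be
  linearized.\<close>

definition sublinear :: "(('k \<Rightarrow> real) \<Rightarrow> real) \<Rightarrow> bool" where
  "sublinear N \<longleftrightarrow> (\<forall>x y. N (\<lambda>k. x k + y k) \<le> N x + N y) \<and>
     (\<forall>t x. 0 < t \<longrightarrow> N (\<lambda>k. t * x k) \<le> t * N x)"

lemma sublinear_add: "sublinear N \<Longrightarrow> N (\<lambda>k. x k + y k) \<le> N x + N y"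
  by (simp add: sublinear_def)

lemma sublinear_scale_le: "sublinear N \<Longrightarrow> 0 < t \<Longrightarrow> N (\<lambda>k. t * x k) \<le> t * N x"
  by (simp add: sublinear_def)

lemma sublinear_scale:
  assumes N: "sublinear N" and t: "0 < t"
  shows "N (\<lambda>k. t * x k) = t * N x"
proof (rule antisym)
  show "N (\<lambda>k. t * x k) \<le> t * N x" by (rule sublinear_scale_le[OF N t])
  have "N (\<lambda>k. inverse t * (t * x k)) \<le> inverse t * N (\<lambda>k. t * x k)"
    using sublinear_scale_le[OF N, of "inverse t"] t by simp
  moreover have "(\<lambda>k. inverse t * (t * x k)) = x" using t by (simp add: mult.assoc[symmetric])
  ultimately show "t * N x \<le> N (\<lambda>k. t * x k)" using t by (simp add: field_simps)
qed

lemma sublinear_zero: "sublinear N \<Longrightarrow> N (\<lambda>k. 0) = 0"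
  using sublinear_scale[of N 2 "\<lambda>k. 0"] by simp

lemma sublinear_neg_ge:
  assumes "sublinear N"
  shows "- N (\<lambda>k. - x k) \<le> N x"
  using sublinear_add[OF assms, of x "\<lambda>k. - x k"] sublinear_zero[OF assms] by simp

text \<open>The infimum forces linearity along the line spanned by \<open>w\<close>; lowering a sublinear function
  further cannot destroy linearity along a line, so directions can be treated one after another.\<close>

lemma sublinear_linearize:
  assumes N: "sublinear N"
  obtains N' where "sublinear N'" "\<And>x. N' x \<le> N x" "N' (\<lambda>k. - w k) \<le> - N w"
proof -
  \<comment> \<open>If \<open>P\<close> is sublinear, lies below \<open>N\<close> and has value at
    most \<open>- N w\<close> at \<open>- w\<close>, then \<open>P x\<close> is at most the sum of
    \<open>P\<close> at \<open>x + t * w\<close> and \<open>t\<close> times \<open>P\<close> at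
    \<open>- w\<close>, hence at most \<open>g x t\<close>. So the infimum over
    \<open>t \<ge> 0\<close> is the greatest possible candidate.\<close>
  define g where "g x t = N (\<lambda>k. x k + t * w k) - t * N w" for x t
  define N' where "N' x = (INF t\<in>{0..}. g x t)" for x
  have scale0: "N (\<lambda>k. t * w k) = t * N w" if "t \<ge> 0" for t
    using sublinear_scale[OF N, of t] sublinear_zero[OF N] that by (cases "t = 0") auto
  \<comment> \<open>Subadditivity for \<open>t * w = (x + t * w) + (- x)\<close> bounds
    \<open>g x\<close> below uniformly in \<open>t\<close>, so the real infimum is a genuine
    one.\<close>
  have lower: "- N (\<lambda>k. - x k) \<le> g x t" if "t \<ge> 0" for x t
    using sublinear_add[OF N, of "\<lambda>k. x k + t * w k" "\<lambda>k. - x k"] scale0[OF that]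
    by (simp add: g_def)
  have bdd: "bdd_below (g x ` {0..})" for x
    using lower[of _ x] by (intro bdd_belowI2[of _ "- N (\<lambda>k. - x k)"]) auto
  have N'_le: "N' x \<le> g x t" if "t \<ge> 0" for x t
    unfolding N'_def using bdd that by (intro cINF_lower) auto
  have N'_ge: "z \<le> N' x" if "\<And>t. t \<ge> 0 \<Longrightarrow> z \<le> g x t" for z x
    unfolding N'_def using that by (intro cINF_greatest) auto
  have "N' (\<lambda>k. x k + y k) \<le> N' x + N' y" for x y
  proof -
    have "N' (\<lambda>k. x k + y k) \<le> g x s + g y t" if "s \<ge> 0" "t \<ge> 0" for s t
    proof -
      have "N' (\<lambda>k. x k + y k) \<le> g (\<lambda>k. x k + y k) (s + t)"
        using that by (intro N'_le) auto
      also have "\<dots> \<le> g x s + g y t"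
        using sublinear_add[OF N, of "\<lambda>k. x k + s * w k" "\<lambda>k. y k + t * w k"]
        by (simp add: g_def algebra_simps)
      finally show ?thesis .
    qed
    \<comment> \<open>The two infima are taken one after the other: over \<open>s\<close> with
      \<open>t\<close> fixed, then over \<open>t\<close>.\<close>
    then have "N' (\<lambda>k. x k + y k) - g y t \<le> N' x" if "t \<ge> 0" for t
      using that by (intro N'_ge) (simp add: algebra_simps)
    then have "N' (\<lambda>k. x k + y k) - N' x \<le> N' y"
      by (intro N'_ge) (simp add: algebra_simps)
    then show ?thesis by simp
  qed
  moreover have "N' (\<lambda>k. r * x k) \<le> r * N' x" if r: "r > 0" for r x
  proof -
    have "N' (\<lambda>k. r * x k) / r \<le> g x t" if t: "t \<ge> 0" for t
    proof -
      have "N' (\<lambda>k. r * x k) \<le> g (\<lambda>k. r * x k) (r * t)"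
        using r t by (intro N'_le) auto
      also have "\<dots> \<le> r * g x t"
        using sublinear_scale[OF N r, of "\<lambda>k. x k + t * w k"]
        by (simp add: g_def algebra_simps)
      finally show ?thesis using r by (simp add: field_simps)
    qed
    then have "N' (\<lambda>k. r * x k) / r \<le> N' x" by (rule N'_ge)
    then show ?thesis using r by (simp add: field_simps)
  qed
  ultimately have "sublinear N'" by (auto simp: sublinear_def)
  moreover have "N' x \<le> N x" for x using N'_le[of 0 x] by (simp add: g_def)
  moreover have "N' (\<lambda>k. - w k) \<le> - N w"
    using N'_le[of 1 "\<lambda>k. - w k"] sublinear_zero[OF N] by (simp add: g_def)
  ultimately show thesis by (rule that)
qed

lemma sublinear_linearize_finite:
  assumes "finite W" "sublinear N"
  obtains N' where "sublinear N'" "\<And>x. N' x \<le> N x"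
    "\<And>w. w \<in> W \<Longrightarrow> N' (\<lambda>k. - w k) = - N' w"
proof -
  \<comment> \<open>The induction carries only the inequality that survives lowering; the opposite
    one holds for every sublinear function and is added at the end.\<close>
  have "\<exists>N'. sublinear N' \<and> (\<forall>x. N' x \<le> N x) \<and> (\<forall>w\<in>W. N' (\<lambda>k. - w k) \<le> - N' w)"
    using assms
  proof (induction W)
    case empty
    then show ?case by auto
  next
    case (insert w W)
    then obtain N1 where N1: "sublinear N1" "\<And>x. N1 x \<le> N x"
      "\<And>v. v \<in> W \<Longrightarrow> N1 (\<lambda>k. - v k) \<le> - N1 v" by blast
    obtain N2 where N2: "sublinear N2" "\<And>x. N2 x \<le> N1 x" "N2 (\<lambda>k. - w k) \<le> - N1 w"
      using sublinear_linearize[OF N1(1)] by blast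
    have "N2 (\<lambda>k. - v k) \<le> - N2 v" if "v \<in> insert w W" for v
    proof (cases "v = w")
      case True
      then show ?thesis using N2(3) N2(2)[of w] by simp
    next
      case False
      then have "N1 (\<lambda>k. - v k) \<le> - N1 v" using that N1(3) by simp
      then show ?thesis using N2(2)[of v] N2(2)[of "\<lambda>k. - v k"] by linarith
    qed
    moreover have "N2 x \<le> N x" for x using N2(2)[of x] N1(2)[of x] by linarith
    ultimately show ?case using N2(1) by blast
  qed
  then obtain N' where N': "sublinear N'" "\<And>x. N' x \<le> N x"
    "\<And>w. w \<in> W \<Longrightarrow> N' (\<lambda>k. - w k) \<le> - N' w" by blast
  have "N' (\<lambda>k. - w k) = - N' w" if "w \<in> W" for w
    using N'(3)[OF that] sublinear_neg_ge[OF N'(1), of w] by linarith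
  then show thesis using N'(1,2) that by blast
qed

text \<open>Linearizing along \<open>v\<close> first freezes the value there: a sublinear
  \<open>P\<close> below \<open>N1\<close> satisfies
  \<open>P v \<ge> - P (- v) \<ge> - N1 (- v) \<ge> N v\<close>, with negation read pointwise.
  Linearizing along the unit vectors of \<open>D\<close> afterwards leaves a function that is linear
  on vectors supported in \<open>D\<close>, and \<open>F\<close> lists its coefficients.\<close>

lemma finite_Hahn_Banach:
  fixes N :: "('k \<Rightarrow> real) \<Rightarrow> real"
  assumes D: "finite D" and N: "sublinear N" and v: "\<And>k. k \<notin> D \<Longrightarrow> v k = 0"
  obtains F where "N v \<le> (\<Sum>k\<in>D. F k * v k)"
    "\<And>x. (\<And>k. k \<notin> D \<Longrightarrow> x k = 0) \<Longrightarrow> (\<Sum>k\<in>D. F k * x k) \<le> N x"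
proof -
  define e where "e k = (\<lambda>l. if l = k then 1 else 0 :: real)" for k :: 'k
  obtain N1 where N1: "sublinear N1" "\<And>x. N1 x \<le> N x" "N1 (\<lambda>k. - v k) \<le> - N v"
    using sublinear_linearize[OF N] by blast
  obtain N2 where N2: "sublinear N2" "\<And>x. N2 x \<le> N1 x"
    "\<And>w. w \<in> e ` D \<Longrightarrow> N2 (\<lambda>k. - w k) = - N2 w"
    using sublinear_linearize_finite[OF finite_imageI[OF D] N1(1)] by blast
  define F where "F k = N2 (e k)" for k
  have scale: "N2 (\<lambda>l. r * e k l) = r * F k" if "k \<in> D" for k r
  proof -
    consider "r > 0" | "r = 0" | "r < 0" by linarith
    then show ?thesis
    proof cases
      case 1
      then show ?thesis using sublinear_scale[OF N2(1)] by (simp add: F_def)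
    next
      case 2
      then show ?thesis using sublinear_zero[OF N2(1)] by simp
    next
      case 3
      then have "N2 (\<lambda>l. (- r) * (- e k l)) = (- r) * N2 (\<lambda>l. - e k l)"
        by (intro sublinear_scale[OF N2(1)]) auto
      then show ?thesis using N2(3)[of "e k"] that by (simp add: F_def)
    qed
  qed
  \<comment> \<open>Subadditivity yields one half of additivity; the other half comes from applying
    this bound to \<open>- x\<close> below.\<close>
  have sum_le: "N2 (\<lambda>l. \<Sum>k\<in>E. x k * e k l) \<le> (\<Sum>k\<in>E. F k * x k)" if "E \<subseteq> D" for x E
    using finite_subset[OF that D] that
  proof (induction E)
    case empty
    then show ?case using sublinear_zero[OF N2(1)] by simp
  next
    case (insert k E)
    then show ?case
      using sublinear_add[OF N2(1), of "\<lambda>l. x k * e k l" "\<lambda>l. \<Sum>k\<in>E. x k * e k l"] scale[of k "x k"]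
      by (simp add: mult.commute)
  qed
  have expand: "(\<lambda>l. \<Sum>k\<in>D. x k * e k l) = x" if "\<And>k. k \<notin> D \<Longrightarrow> x k = 0" for x
  proof
    fix l
    have "(\<Sum>k\<in>D. x k * e k l) = (\<Sum>k\<in>D. if l = k then x k else 0)"
      by (intro sum.cong) (auto simp: e_def)
    also have "\<dots> = x l" using D that[of l] by (simp add: sum.delta)
    finally show "(\<Sum>k\<in>D. x k * e k l) = x l" .
  qed
  have N2_le: "N2 x \<le> (\<Sum>k\<in>D. F k * x k)" if "\<And>k. k \<notin> D \<Longrightarrow> x k = 0" for x
    using sum_le[of D x] expand[OF that] by simp
  have "N v \<le> (\<Sum>k\<in>D. F k * v k)"
    using N2_le[of v, OF v] sublinear_neg_ge[OF N2(1), of v] N2(2)[of "\<lambda>k. - v k"] N1(3) by linarith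
  moreover have "(\<Sum>k\<in>D. F k * x k) \<le> N x" if x: "\<And>k. k \<notin> D \<Longrightarrow> x k = 0" for x
  proof -
    have "(\<Sum>k\<in>D. F k * x k) = - (\<Sum>k\<in>D. F k * (- x k))" by (simp add: sum_negf)
    also have "\<dots> \<le> - N2 (\<lambda>k. - x k)" using N2_le[of "\<lambda>k. - x k"] x by simp
    also have "\<dots> \<le> N x"
      using sublinear_neg_ge[OF N2(1), of x] N2(2)[of x] N1(2)[of x] by linarith
    finally show ?thesis .
  qed
  ultimately show thesis by (rule that)
qed

text \<open>The marginals of \<open>p\<close> are not required to lie below \<open>a\<close> and \<open>b\<close>. This makes the optimal value
  sublinear in \<open>(a, b)\<close> on the whole space.\<close>

lemma finite_unbalanced_transport_duality:
  fixes a :: "'i \<Rightarrow> real" and b :: "'j \<Rightarrow> real" and c :: "'i \<Rightarrow> 'j \<Rightarrow> real"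
  assumes I: "finite I" and J: "finite J" and c: "\<And>i j. 0 \<le> c i j" and \<epsilon>: "0 < \<epsilon>"
  obtains p f g where "\<And>i j. 0 \<le> p i j"
    "\<And>i. i \<in> I \<Longrightarrow> \<bar>f i\<bar> \<le> 1" "\<And>j. j \<in> J \<Longrightarrow> \<bar>g j\<bar> \<le> 1"
    "\<And>i j. i \<in> I \<Longrightarrow> j \<in> J \<Longrightarrow> f i + g j \<le> c i j"
    "(\<Sum>i\<in>I. \<bar>a i - (\<Sum>j\<in>J. p i j)\<bar>) + (\<Sum>j\<in>J. \<bar>b j - (\<Sum>i\<in>I. p i j)\<bar>)
       + (\<Sum>i\<in>I. \<Sum>j\<in>J. p i j * c i j)
     \<le> (\<Sum>i\<in>I. f i * a i) + (\<Sum>j\<in>J. g j * b j) + \<epsilon>"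
proof -
  \<comment> \<open>A pair of weight vectors is encoded as one vector on the disjoint sum.
    \<open>C p x\<close> is the cost of the plan \<open>p\<close> plus the deviation of its
    marginals from the weights, at unit price.\<close>
  define C where "C p x = (\<Sum>i\<in>I. \<bar>x (Inl i) - (\<Sum>j\<in>J. p i j)\<bar>) +
      (\<Sum>j\<in>J. \<bar>x (Inr j) - (\<Sum>i\<in>I. p i j)\<bar>) + (\<Sum>i\<in>I. \<Sum>j\<in>J. p i j * c i j)"
    for p and x :: "'i + 'j \<Rightarrow> real"
  define \<P> where "\<P> = {p. \<forall>i j. (0::real) \<le> p (i::'i) (j::'j)}"
  define N where "N x = (INF p\<in>\<P>. C p x)" for x
  have zeroP: "(\<lambda>i j. 0) \<in> \<P>" by (simp add: \<P>_def)
  then have neP: "\<P> \<noteq> {}" by blast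
  have C_nonneg: "0 \<le> C p x" if "p \<in> \<P>" for p x
    unfolding C_def using that c by (intro add_nonneg_nonneg sum_nonneg) (auto simp: \<P>_def)
  have bdd: "bdd_below ((\<lambda>p. C p x) ` \<P>)" for x
    using C_nonneg by (intro bdd_belowI2[of _ 0]) auto
  have N_le: "N x \<le> C p x" if "p \<in> \<P>" for p x
    unfolding N_def using bdd that by (intro cINF_lower) auto
  have N_ge: "z \<le> N x" if "\<And>p. p \<in> \<P> \<Longrightarrow> z \<le> C p x" for z x
    unfolding N_def using that neP by (intro cINF_greatest) auto
  \<comment> \<open>\<open>C\<close> is jointly sublinear in plan and weights, and plans form a
    convex cone, so minimizing over plans leaves a sublinear function of the weights.\<close>
  have "N (\<lambda>k. x k + y k) \<le> N x + N y" for x y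
  proof -
    have "N (\<lambda>k. x k + y k) \<le> C p x + C q y" if "p \<in> \<P>" "q \<in> \<P>" for p q
    proof -
      have "N (\<lambda>k. x k + y k) \<le> C (\<lambda>i j. p i j + q i j) (\<lambda>k. x k + y k)"
        using that by (intro N_le) (auto simp: \<P>_def)
      also have "\<dots> \<le>
          ((\<Sum>i\<in>I. \<bar>x (Inl i) - (\<Sum>j\<in>J. p i j)\<bar>) + (\<Sum>i\<in>I. \<bar>y (Inl i) - (\<Sum>j\<in>J. q i j)\<bar>)) +
          ((\<Sum>j\<in>J. \<bar>x (Inr j) - (\<Sum>i\<in>I. p i j)\<bar>) + (\<Sum>j\<in>J. \<bar>y (Inr j) - (\<Sum>i\<in>I. q i j)\<bar>)) +
          ((\<Sum>i\<in>I. \<Sum>j\<in>J. p i j * c i j) + (\<Sum>i\<in>I. \<Sum>j\<in>J. q i j * c i j))"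
        unfolding C_def sum.distrib[symmetric]
        by (intro add_mono sum_mono) (auto simp: sum.distrib algebra_simps)
      also have "\<dots> = C p x + C q y" by (simp add: C_def)
      finally show ?thesis .
    qed
    then have "N (\<lambda>k. x k + y k) - C q y \<le> N x" if "q \<in> \<P>" for q
      using that by (intro N_ge) (simp add: algebra_simps)
    then have "N (\<lambda>k. x k + y k) - N x \<le> N y"
      by (intro N_ge) (simp add: algebra_simps)
    then show ?thesis by simp
  qed
  moreover have "N (\<lambda>k. r * x k) \<le> r * N x" if r: "r > 0" for r x
  proof -
    have "N (\<lambda>k. r * x k) / r \<le> C p x" if p: "p \<in> \<P>" for p
    proof -
      have "N (\<lambda>k. r * x k) \<le> C (\<lambda>i j. r * p i j) (\<lambda>k. r * x k)"
        using r p by (intro N_le) (auto simp: \<P>_def)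
      also have "\<dots> = r * C p x"
        using r unfolding C_def distrib_left sum_distrib_left[symmetric] right_diff_distrib[symmetric]
        by (simp add: abs_mult sum_distrib_left mult.assoc)
      finally show ?thesis using r by (simp add: field_simps)
    qed
    then have "N (\<lambda>k. r * x k) / r \<le> N x" by (rule N_ge)
    then show ?thesis using r by (simp add: field_simps)
  qed
  ultimately have sub: "sublinear N" by (auto simp: sublinear_def)
  define D where "D = I <+> J"
  have D: "finite D" using I J by (simp add: D_def)
  define v where "v k = (if k \<in> D then (case k of Inl i \<Rightarrow> a i | Inr j \<Rightarrow> b j) else 0)" for k
  obtain F where F: "N v \<le> (\<Sum>k\<in>D. F k * v k)"
    "\<And>x. (\<And>k. k \<notin> D \<Longrightarrow> x k = 0) \<Longrightarrow> (\<Sum>k\<in>D. F k * x k) \<le> N x"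
    using finite_Hahn_Banach[OF D sub, of v] by (auto simp: v_def)
  have sumD: "(\<Sum>k\<in>D. h k) = (\<Sum>i\<in>I. h (Inl i)) + (\<Sum>j\<in>J. h (Inr j))" for h :: "_ \<Rightarrow> real"
    unfolding D_def using I J by (simp add: sum.Plus)
  \<comment> \<open>Test the functional on \<open>s\<close> times a unit vector: the zero plan
    discards this weight at price \<open>\<bar>s\<bar>\<close>. Then take \<open>s = 1\<close> and
    \<open>s = -1\<close>.\<close>
  have absF: "\<bar>F k\<bar> \<le> 1" if k: "k \<in> D" for k
  proof -
    have *: "F k * s \<le> \<bar>s\<bar>" for s
    proof -
      define x where "x = (\<lambda>l. if l = k then s else 0)"
      have "(\<Sum>l\<in>D. F l * x l) = (\<Sum>l\<in>D. if l = k then F l * s else 0)"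
        unfolding x_def by (intro sum.cong) auto
      also have "\<dots> = F k * s" using D k by simp
      finally have "F k * s = (\<Sum>l\<in>D. F l * x l)" by simp
      also have "\<dots> \<le> N x" using k by (intro F(2)) (auto simp: x_def)
      also have "\<dots> \<le> C (\<lambda>i j. 0) x" by (rule N_le[OF zeroP])
      also have "\<dots> = (\<Sum>l\<in>D. \<bar>x l\<bar>)" by (simp add: C_def sumD)
      also have "\<dots> = (\<Sum>l\<in>D. if l = k then \<bar>s\<bar> else 0)"
        unfolding x_def by (intro sum.cong) auto
      also have "\<dots> = \<bar>s\<bar>" using D k by simp
      finally show ?thesis .
    qed
    show ?thesis using *[of 1] *[of "-1"] by simp
  qed
  \<comment> \<open>Test the functional on unit weights at \<open>i\<close> and \<open>j\<close>:
    the plan sending unit mass from \<open>i\<close> to \<open>j\<close> matches both marginals and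
    costs exactly \<open>c i j\<close>.\<close>
  have Fc: "F (Inl i) + F (Inr j) \<le> c i j" if i: "i \<in> I" and j: "j \<in> J" for i j
  proof -
    define x where "x = (\<lambda>l. if l = Inl i \<or> l = Inr j then 1 else 0 :: real)"
    define p where "p = (\<lambda>i' j'. if i' = i \<and> j' = j then 1 else 0 :: real)"
    have rI: "(\<Sum>i'\<in>I. if i' = i then h i' else 0) = h i" for h :: "'i \<Rightarrow> real"
      using I i by simp
    have rJ: "(\<Sum>j'\<in>J. if j' = j then h j' else 0) = h j" for h :: "'j \<Rightarrow> real"
      using J j by simp
    have "F (Inl i) + F (Inr j) = (\<Sum>i'\<in>I. if i' = i then F (Inl i') else 0) +
        (\<Sum>j'\<in>J. if j' = j then F (Inr j') else 0)"
      using rI[of "\<lambda>i. F (Inl i)"] rJ[of "\<lambda>j. F (Inr j)"] by simp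
    also have "\<dots> = (\<Sum>l\<in>D. F l * x l)"
      unfolding sumD x_def by (intro arg_cong2[of _ _ _ _ "(+)"] sum.cong) auto
    also have "\<dots> \<le> N x" using i j by (intro F(2)) (auto simp: x_def D_def)
    also have "\<dots> \<le> C p x" by (intro N_le) (auto simp: \<P>_def p_def)
    also have "\<dots> = c i j"
    proof -
      have r: "(\<Sum>j'\<in>J. p i' j') = x (Inl i')" for i'
        using rJ[of "\<lambda>_. 1"] by (cases "i' = i") (auto simp: p_def x_def)
      have s: "(\<Sum>i'\<in>I. p i' j') = x (Inr j')" for j'
        using rI[of "\<lambda>_. 1"] by (cases "j' = j") (auto simp: p_def x_def)
      have "(\<Sum>i'\<in>I. \<Sum>j'\<in>J. p i' j' * c i' j') = (\<Sum>i'\<in>I. if i' = i then c i' j else 0)"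
      proof (intro sum.cong refl)
        fix i' assume "i' \<in> I"
        have "(\<Sum>j'\<in>J. p i' j' * c i' j') = (\<Sum>j'\<in>J. if j' = j then p i' j' * c i' j' else 0)"
          by (intro sum.cong) (auto simp: p_def)
        also have "\<dots> = p i' j * c i' j" by (rule rJ)
        finally show "(\<Sum>j'\<in>J. p i' j' * c i' j') = (if i' = i then c i' j else 0)"
          by (simp add: p_def)
      qed
      also have "\<dots> = c i j" by (rule rI)
      finally show ?thesis by (simp add: C_def r s)
    qed
    finally show ?thesis .
  qed
  have "\<exists>p\<in>\<P>. C p v < N v + \<epsilon>"
  proof (rule ccontr)
    assume "\<not> ?thesis"
    then have "N v + \<epsilon> \<le> N v" by (intro N_ge) (auto simp: not_less)
    then show False using \<epsilon> by simp
  qed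
  then obtain p where p: "p \<in> \<P>" "C p v < N v + \<epsilon>" by blast
  have "C p v = (\<Sum>i\<in>I. \<bar>a i - (\<Sum>j\<in>J. p i j)\<bar>) + (\<Sum>j\<in>J. \<bar>b j - (\<Sum>i\<in>I. p i j)\<bar>)
       + (\<Sum>i\<in>I. \<Sum>j\<in>J. p i j * c i j)"
    unfolding C_def by (intro arg_cong2[of _ _ _ _ "(+)"] sum.cong) (auto simp: v_def D_def)
  moreover have "(\<Sum>k\<in>D. F k * v k) = (\<Sum>i\<in>I. F (Inl i) * a i) + (\<Sum>j\<in>J. F (Inr j) * b j)"
    unfolding sumD by (intro arg_cong2[of _ _ _ _ "(+)"] sum.cong) (auto simp: v_def D_def)
  ultimately show thesis
    using p F(1) absF Fc
    by (intro that[of p "\<lambda>i. F (Inl i)" "\<lambda>j. F (Inr j)"]) (auto simp: \<P>_def D_def)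
qed

section \<open>Total variation, transport cost and test functions\<close>

text \<open>The relation \<open>M - N = P - Q\<close> is rearranged to \<open>M + Q = N + P\<close>,
  which makes sense with values in \<open>[0, \<infinity>]\<close>. In this form it passes from sets
  to functions by the standard induction, since increasing limits commute with sums.\<close>

lemma nn_integral_cong_sum_measures:
  assumes s: "sets M = sets B" "sets N = sets B" "sets P = sets B" "sets Q = sets B"
    and e: "\<And>A. A \<in> sets B \<Longrightarrow> emeasure M A + emeasure Q A = emeasure N A + emeasure P A"
    and u: "u \<in> borel_measurable B"
  shows "(\<integral>\<^sup>+x. u x \<partial>M) + (\<integral>\<^sup>+x. u x \<partial>Q) = (\<integral>\<^sup>+x. u x \<partial>N) + (\<integral>\<^sup>+x. u x \<partial>P)"
  using u
proof (induction u rule: borel_measurable_induct)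
  case (cong f g)
  have "(\<integral>\<^sup>+x. f x \<partial>K) = (\<integral>\<^sup>+x. g x \<partial>K)" if "sets K = sets B" for K
    using cong sets_eq_imp_space_eq[OF that] by (intro nn_integral_cong) auto
  then show ?case using cong s by simp
next
  case (set A)
  then show ?case using e s by simp
next
  case (mult u c)
  have "u \<in> borel_measurable K" if "sets K = sets B" for K
    using mult(2) that by (simp cong: measurable_cong_sets)
  then show ?case using mult s by (simp add: nn_integral_cmult distrib_left[symmetric])
next
  case (add u v)
  have "u \<in> borel_measurable K" "v \<in> borel_measurable K" if "sets K = sets B" for K
    using add that by (simp_all cong: measurable_cong_sets)
  then show ?case using add s by (simp add: nn_integral_add) (metis (no_types, opaque_lifting) add.assoc add.commute)
next
  case (seq U)
  have m: "U i \<in> borel_measurable K" if "sets K = sets B" for K i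
    using seq(1)[of i] that by (simp cong: measurable_cong_sets)
  have *: "(\<integral>\<^sup>+x. (SUP i. U i) x \<partial>K) = (SUP i. \<integral>\<^sup>+x. U i x \<partial>K)" if "sets K = sets B" for K
    using m[OF that] seq by (simp add: nn_integral_monotone_convergence_SUP[symmetric] image_comp)
  have inc: "incseq (\<lambda>i. \<integral>\<^sup>+x. U i x \<partial>K)" for K
    using \<open>incseq U\<close> by (auto simp: incseq_def le_fun_def intro!: nn_integral_mono)
  have "(SUP i. \<integral>\<^sup>+x. U i x \<partial>M) + (SUP i. \<integral>\<^sup>+x. U i x \<partial>Q) =
      (SUP i. (\<integral>\<^sup>+x. U i x \<partial>M) + (\<integral>\<^sup>+x. U i x \<partial>Q))"
    using inc by (intro ennreal_SUP_add[symmetric])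
  also have "\<dots> = (SUP i. (\<integral>\<^sup>+x. U i x \<partial>N) + (\<integral>\<^sup>+x. U i x \<partial>P))"
    using seq.IH by simp
  also have "\<dots> = (SUP i. \<integral>\<^sup>+x. U i x \<partial>N) + (SUP i. \<integral>\<^sup>+x. U i x \<partial>P)"
    using inc by (intro ennreal_SUP_add)
  finally show ?case using * s by simp
qed

lemma fin_meas_integrable_bounded:
  fixes f :: "'a::euclidean_space \<Rightarrow> real"
  assumes "M \<in> fin_meas" "f \<in> borel_measurable borel" "\<And>x. \<bar>f x\<bar> \<le> B"
  shows "integrable M f"
proof -
  interpret finite_measure M using assms by (simp add: fin_meas_iff)
  have "f \<in> borel_measurable M"
    using assms by (simp add: fin_meas_iff cong: measurable_cong_sets)
  then show ?thesis using assms(3) by (intro integrable_const_bound[of _ B]) auto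
qed

lemma abs_integral_le_mass:
  fixes f :: "'a::euclidean_space \<Rightarrow> real"
  assumes M: "M \<in> fin_meas" and f: "f \<in> borel_measurable borel" "\<And>x. \<bar>f x\<bar> \<le> 1"
  shows "\<bar>\<integral>x. f x \<partial>M\<bar> \<le> mass M"
proof -
  interpret finite_measure M using M by (simp add: fin_meas_iff)
  have sp: "space M = UNIV" using M sets_eq_imp_space_eq[of M borel] by (simp add: fin_meas_iff)
  have "\<bar>\<integral>x. f x \<partial>M\<bar> \<le> (\<integral>x. \<bar>f x\<bar> \<partial>M)" by (rule integral_abs_bound)
  also have "\<dots> \<le> (\<integral>x. 1 \<partial>M)"
    using fin_meas_integrable_bounded[OF M f] f(2) by (intro integral_mono) auto
  also have "\<dots> = mass M" by (simp add: mass_def sp)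
  finally show ?thesis .
qed

text \<open>After replacing \<open>M - N\<close> by its Jordan parts \<open>P - Q\<close>, each of
  the two integrals is bounded by the mass of its part.\<close>

lemma integral_diff_le_total_variation:
  fixes f :: "'a::euclidean_space \<Rightarrow> real"
  assumes M: "M \<in> fin_meas" and N: "N \<in> fin_meas"
    and f: "f \<in> borel_measurable borel" "\<And>x. \<bar>f x\<bar> \<le> 1"
  shows "\<bar>(\<integral>x. f x \<partial>M) - (\<integral>x. f x \<partial>N)\<bar> \<le> total_variation (meas_diff M N)"
proof -
  obtain P Q where J: "jordan_decomp (meas_diff M N) P Q"
    using jordan_decomp_exists[OF M N] by blast
  then have P: "P \<in> fin_meas" and Q: "Q \<in> fin_meas"
    and d: "\<And>B. B \<in> sets borel \<Longrightarrow> measure M B - measure N B = measure P B - measure Q B"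
    by (auto simp: jordan_decomp_def meas_diff_def)
  have e: "emeasure M B + emeasure Q B = emeasure N B + emeasure P B" if "B \<in> sets borel" for B
  proof -
    have "emeasure K B = ennreal (measure K B)" if "K \<in> fin_meas" for K
      using that finite_measure.emeasure_eq_measure by (auto simp: fin_meas_iff)
    then show ?thesis
      using M N P Q d[OF that] by (simp add: ennreal_plus[symmetric] del: ennreal_plus)
  qed
  have nn: "(\<integral>x. g x \<partial>M) + (\<integral>x. g x \<partial>Q) = (\<integral>x. g x \<partial>N) + (\<integral>x. g x \<partial>P)"
    if g: "g \<in> borel_measurable borel" "\<And>x. 0 \<le> g x" "\<And>x. g x \<le> 2" for g :: "'a \<Rightarrow> real"
  proof -
    have "\<bar>g x\<bar> \<le> 2" for x using g(2,3)[of x] by simp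
    then have *: "(\<integral>\<^sup>+x. ennreal (g x) \<partial>K) = ennreal (\<integral>x. g x \<partial>K)" if "K \<in> fin_meas" for K
      using fin_meas_integrable_bounded[OF that g(1)] g(2) by (intro nn_integral_eq_integral) auto
    have "(\<integral>\<^sup>+x. ennreal (g x) \<partial>M) + (\<integral>\<^sup>+x. ennreal (g x) \<partial>Q) =
        (\<integral>\<^sup>+x. ennreal (g x) \<partial>N) + (\<integral>\<^sup>+x. ennreal (g x) \<partial>P)"
      using M N P Q e g(1) by (intro nn_integral_cong_sum_measures[where B=borel]) (auto simp: fin_meas_iff)
    then show ?thesis
      using M N P Q g(2) by (simp add: * ennreal_plus[symmetric] del: ennreal_plus)
  qed
  \<comment> \<open>Shifting \<open>f\<close> by \<open>1\<close> puts its values in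
    \<open>[0, 2]\<close>, where the identity for nonnegative functions applies; the same identity
    for the constant \<open>1\<close> removes the shift.\<close>
  have "(\<integral>x. f x + 1 \<partial>K) = (\<integral>x. f x \<partial>K) + (\<integral>x. 1 \<partial>K)" if "K \<in> fin_meas" for K
    using fin_meas_integrable_bounded[OF that f] fin_meas_integrable_bounded[OF that, of "\<lambda>_. 1" 1]
    by (intro Bochner_Integration.integral_add) auto
  moreover have "0 \<le> f x + 1" "f x + 1 \<le> 2" for x using f(2)[of x] by auto
  ultimately have "(\<integral>x. f x \<partial>M) - (\<integral>x. f x \<partial>N) = (\<integral>x. f x \<partial>P) - (\<integral>x. f x \<partial>Q)"
    using nn[of "\<lambda>x. f x + 1"] nn[of "\<lambda>_. 1"] f(1) M N P Q by simp
  then show ?thesis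
    using abs_integral_le_mass[OF P f] abs_integral_le_mass[OF Q f] total_variation_eq[OF J] by linarith
qed

text \<open>The set carrying the positive Jordan part already determines the variation, so an upper
  bound follows by estimating \<open>M - N\<close> on one set and on its complement, without
  computing the Jordan parts.\<close>

lemma total_variation_Hahn:
  fixes M N :: "'a::euclidean_space measure"
  assumes M: "M \<in> fin_meas" and N: "N \<in> fin_meas"
  obtains A where "A \<in> sets borel" "total_variation (meas_diff M N) =
      (measure M A - measure N A) + (measure N (- A) - measure M (- A))"
proof -
  obtain P Q where J: "jordan_decomp (meas_diff M N) P Q"
    using jordan_decomp_exists[OF M N] by blast
  then obtain A where A: "A \<in> sets borel" "emeasure P (- A) = 0" "emeasure Q A = 0"
    and P: "P \<in> fin_meas" and Q: "Q \<in> fin_meas"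
    and d: "\<And>B. B \<in> sets borel \<Longrightarrow> measure M B - measure N B = measure P B - measure Q B"
    by (auto simp: jordan_decomp_def meas_diff_def)
  have split: "mass K = measure K A + measure K (- A)" if "K \<in> fin_meas" for K
  proof -
    interpret K: finite_measure K using that by (simp add: fin_meas_iff)
    have "measure K (A \<union> - A) = measure K A + measure K (- A)"
      using that A(1) by (intro K.finite_measure_Union) (auto simp: fin_meas_iff)
    then show ?thesis by (simp add: mass_def)
  qed
  have "measure P (- A) = 0" "measure Q A = 0" using A by (auto simp: measure_def)
  then have "total_variation (meas_diff M N) =
      (measure M A - measure N A) + (measure N (- A) - measure M (- A))"
    using split[OF P] split[OF Q] d[of A] d[of "- A"] A(1) total_variation_eq[OF J] by auto
  then show thesis using A(1) that by blast
qed

text \<open>The signed difference has density \<open>1 - k\<close> with respect to \<open>M\<close>.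
  On the Hahn set and on its complement the variation integrates plus or minus this density, which
  is at most its absolute value.\<close>

lemma total_variation_density_le:
  fixes M :: "'a::euclidean_space measure" and k :: "'a \<Rightarrow> real"
  assumes M: "M \<in> fin_meas" and k: "k \<in> borel_measurable borel" "\<And>x. 0 \<le> k x" "integrable M k"
  shows "density M (\<lambda>x. ennreal (k x)) \<in> fin_meas"
    and "total_variation (meas_diff M (density M (\<lambda>x. ennreal (k x)))) \<le> (\<integral>x. \<bar>1 - k x\<bar> \<partial>M)"
proof -
  interpret M: finite_measure M using M by (simp add: fin_meas_iff)
  let ?D = "density M (\<lambda>x. ennreal (k x))"
  have sM: "sets M = sets borel" using M by (simp add: fin_meas_iff)
  have kM: "k \<in> borel_measurable M" using k(1) sM by (simp cong: measurable_cong_sets)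
  have iA: "integrable M (\<lambda>x. indicator A x * h x)" if "A \<in> sets borel" "integrable M h" for A and h :: "'a \<Rightarrow> real"
    using integrable_mult_indicator[OF _ that(2), of A] that(1) sM by simp
  have eD: "emeasure ?D A = ennreal (\<integral>x. indicator A x * k x \<partial>M)" if A: "A \<in> sets borel" for A
  proof -
    have "emeasure ?D A = (\<integral>\<^sup>+x. ennreal (indicator A x * k x) \<partial>M)"
      using A sM kM by (subst emeasure_density) (auto intro!: nn_integral_cong simp: indicator_def)
    also have "\<dots> = ennreal (\<integral>x. indicator A x * k x \<partial>M)"
      using iA[OF A k(3)] k(2) by (intro nn_integral_eq_integral) auto
    finally show ?thesis .
  qed
  have "finite_measure ?D"
    using eD[of UNIV] sets_eq_imp_space_eq[OF sM] by (intro finite_measureI) auto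
  then show D: "?D \<in> fin_meas" using sM by (simp add: fin_meas_iff)
  have mD: "measure ?D A = (\<integral>x. indicator A x * k x \<partial>M)" if A: "A \<in> sets borel" for A
    using eD[OF A] k(2) by (simp add: measure_def integral_nonneg)
  have one: "integrable M (\<lambda>x. 1 - k x)" "integrable M (\<lambda>x. \<bar>1 - k x\<bar>)" using k(3) by auto
  have diff: "measure M A - measure ?D A = (\<integral>x. indicator A x * (1 - k x) \<partial>M)" if A: "A \<in> sets borel" for A
  proof -
    have "(\<integral>x. indicator A x * (1 - k x) \<partial>M) = (\<integral>x. indicator A x * 1 - indicator A x * k x \<partial>M)"
      by (simp add: right_diff_distrib)
    also have "\<dots> = (\<integral>x. indicator A x * 1 \<partial>M) - (\<integral>x. indicator A x * k x \<partial>M)"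
      using A k(3) by (intro Bochner_Integration.integral_diff iA) auto
    also have "(\<integral>x. indicator A x * 1 \<partial>M) = measure M A"
      using sets_eq_imp_space_eq[OF sM] by simp
    finally show ?thesis using mD[OF A] by simp
  qed
  obtain A where A: "A \<in> sets borel" "total_variation (meas_diff M ?D) =
      (measure M A - measure ?D A) + (measure ?D (- A) - measure M (- A))"
    using total_variation_Hahn[OF M D] by blast
  have cA: "- A \<in> sets borel" using A(1) by auto
  have "total_variation (meas_diff M ?D) =
      (\<integral>x. indicator A x * (1 - k x) \<partial>M) - (\<integral>x. indicator (- A) x * (1 - k x) \<partial>M)"
    using A diff[OF A(1)] diff[OF cA] by simp
  also have "\<dots> = (\<integral>x. indicator A x * (1 - k x) - indicator (- A) x * (1 - k x) \<partial>M)"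
    using iA[OF A(1) one(1)] iA[OF cA one(1)] by simp
  also have "\<dots> \<le> (\<integral>x. \<bar>1 - k x\<bar> \<partial>M)"
    using iA[OF A(1) one(1)] iA[OF cA one(1)] one(2)
    by (intro integral_mono) (auto simp: indicator_def)
  finally show "total_variation (meas_diff M ?D) \<le> (\<integral>x. \<bar>1 - k x\<bar> \<partial>M)" .
qed

section \<open>Transport cost and Lipschitz functions\<close>

lemma scale_measure_eq_density: "scale_measure r M = density M (\<lambda>_. r)"
  by (intro measure_eqI) (auto simp: emeasure_density nn_integral_cmult_indicator)

text \<open>Allows plans that are not normalized: dividing \<open>G\<close> by the common mass gives
  a coupling, and the factor \<open>mass M\<close> in the definition of the distance cancels the
  division.\<close>

lemma wasserstein1_le_nn_integral:
  fixes M N :: "'a::euclidean_space measure" and G :: "('a \<times> 'a) measure"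
  assumes M: "M \<in> fin_meas"
    and G: "sets G = sets borel" "distr G borel fst = M" "distr G borel snd = N"
  shows "wasserstein1 M N \<le> enn2ereal (\<integral>\<^sup>+ (x, y). ennreal (norm (x - y)) \<partial>G)"
proof (cases "mass M = 0")
  case True
  then show ?thesis by (simp add: wasserstein1_def)
next
  case False
  then have m: "mass M > 0" using measure_nonneg[of M UNIV] unfolding mass_def by linarith
  interpret M: finite_measure M using M by (simp add: fin_meas_iff)
  have sp: "space G = UNIV" using sets_eq_imp_space_eq[OF G(1)] by simp
  have "fst \<in> measurable G borel"
    using G(1) by (simp add: borel_prod[symmetric] cong: measurable_cong_sets)
  then have "emeasure M UNIV = emeasure G UNIV"
    by (subst G(2)[symmetric], subst emeasure_distr) (auto simp: sp)
  then have GU: "emeasure G UNIV = ennreal (mass M)"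
    by (simp add: mass_def M.emeasure_eq_measure)
  define \<pi> where "\<pi> = scale_measure (ennreal (inverse (mass M))) G"
  have inv: "ennreal (mass M) * ennreal (inverse (mass M)) = 1"
    using m by (simp add: ennreal_mult[symmetric])
  then have inv': "ennreal (inverse (mass M)) * ennreal (mass M) = 1" by (simp add: mult.commute)
  have sc: "scale_measure (ennreal (mass M)) \<pi> = G" using inv by (simp add: \<pi>_def)
  have "prob_space \<pi>"
    by (intro prob_spaceI) (simp add: \<pi>_def space_scale_measure sp GU inv')
  then have mem: "\<pi> \<in> couplings M N" using sc G by (simp add: couplings_def \<pi>_def)
  let ?d = "\<lambda>(x::'a, y). ennreal (norm (x - y))"
  have "?d \<in> borel_measurable (borel :: ('a \<times> 'a) measure)"
    by (simp add: borel_prod[symmetric] split_beta')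
  then have d: "?d \<in> borel_measurable \<pi>"
    using G(1) by (simp add: \<pi>_def cong: measurable_cong_sets)
  have "wasserstein1 M N \<le> ereal (mass M) * enn2ereal (\<integral>\<^sup>+ z. ?d z \<partial>\<pi>)"
    unfolding wasserstein1_def using False m mem
    by (auto intro!: ereal_mult_left_mono INF_lower)
  also have "\<dots> = enn2ereal (ennreal (mass M) * (\<integral>\<^sup>+ z. ?d z \<partial>\<pi>))"
    using m by (simp add: times_ennreal.rep_eq)
  also have "ennreal (mass M) * (\<integral>\<^sup>+ z. ?d z \<partial>\<pi>) = (\<integral>\<^sup>+ z. ?d z \<partial>G)"
    using nn_integral_scale_measure[OF d, of "ennreal (mass M)"] sc by simp
  finally show ?thesis .
qed

text \<open>The easy half of Kantorovich duality: integrate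
  \<open>f x - f y \<le> norm (x - y)\<close> against an arbitrary coupling.\<close>

lemma integral_diff_le_wasserstein1:
  fixes M N :: "'a::euclidean_space measure" and f :: "'a \<Rightarrow> real"
  assumes M: "M \<in> fin_meas" and N: "N \<in> fin_meas" and eq: "mass M = mass N"
    and f: "1-lipschitz_on UNIV f" "\<And>x. \<bar>f x\<bar> \<le> 1"
  shows "ereal ((\<integral>x. f x \<partial>M) - (\<integral>x. f x \<partial>N)) \<le> wasserstein1 M N"
proof -
  have fm: "f \<in> borel_measurable borel"
    using lipschitz_on_continuous_on[OF f(1)] by (rule borel_measurable_continuous_onI)
  show ?thesis
  proof (cases "mass M = 0")
    case True
    then show ?thesis
      using abs_integral_le_mass[OF M fm f(2)] abs_integral_le_mass[OF N fm f(2)] eq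
      by (simp add: wasserstein1_def)
  next
    case False
    then have m: "mass M > 0" using measure_nonneg[of M UNIV] unfolding mass_def by linarith
    let ?X = "(\<integral>x. f x \<partial>M) - (\<integral>x. f x \<partial>N)"
    have "ereal (?X / mass M) \<le> enn2ereal (\<integral>\<^sup>+ (x, y). ennreal (norm (x - y)) \<partial>\<pi>)"
      if \<pi>: "\<pi> \<in> couplings M N" for \<pi>
    \<comment> \<open>An infinite cost bounds everything; a finite one makes the distance
      integrable, so that real-valued integrals can be compared.\<close>
    proof (cases "(\<integral>\<^sup>+ (x, y). ennreal (norm (x - y)) \<partial>\<pi>) = \<infinity>")
      case True
      then show ?thesis by simp
    next
      case fin: False
      interpret prob_space \<pi> using \<pi> by (simp add: couplings_def)
      have s: "sets \<pi> = sets (borel \<Otimes>\<^sub>M borel)" using \<pi> unfolding couplings_def borel_prod by simp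
      have [measurable]: "f \<in> borel_measurable borel" by (rule fm)
      have mf: "(\<lambda>z. f (fst z)) \<in> borel_measurable \<pi>" "(\<lambda>z. f (snd z)) \<in> borel_measurable \<pi>"
        "fst \<in> measurable \<pi> borel" "snd \<in> measurable \<pi> borel"
        "(\<lambda>z. norm (fst z - snd z)) \<in> borel_measurable \<pi>"
        using s by (simp_all cong: measurable_cong_sets)
      \<comment> \<open>Viewing the scaled coupling as a density with constant weight brings the
        factor \<open>mass M\<close> out of the integral after the change of variables.\<close>
      have marg: "(\<integral>x. f x \<partial>distr (scale_measure (ennreal (mass M)) \<pi>) borel h) =
          mass M * (\<integral>z. f (h z) \<partial>\<pi>)" if "h \<in> measurable \<pi> borel" for h
        unfolding scale_measure_eq_density using that m fm
        by (subst integral_distr) (auto simp: integral_density intro: measurable_compose)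
      have "(\<integral>x. f x \<partial>M) = mass M * (\<integral>z. f (fst z) \<partial>\<pi>)" "(\<integral>x. f x \<partial>N) = mass M * (\<integral>z. f (snd z) \<partial>\<pi>)"
        using marg[OF mf(3)] marg[OF mf(4)] \<pi> by (auto simp: couplings_def)
      then have X: "?X / mass M = (\<integral>z. f (fst z) \<partial>\<pi>) - (\<integral>z. f (snd z) \<partial>\<pi>)"
        using m by (simp add: right_diff_distrib[symmetric])
      have i: "integrable \<pi> (\<lambda>z. f (fst z))" "integrable \<pi> (\<lambda>z. f (snd z))"
        using mf f(2) by (auto intro!: integrable_const_bound[of _ 1])
      have id: "integrable \<pi> (\<lambda>z. norm (fst z - snd z))"
        using mf(5) fin by (intro integrableI_bounded) (auto simp: split_beta' less_top)
      have "?X / mass M = (\<integral>z. f (fst z) - f (snd z) \<partial>\<pi>)" using X i by simp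
      also have "\<dots> \<le> (\<integral>z. norm (fst z - snd z) \<partial>\<pi>)"
      proof (intro integral_mono id Bochner_Integration.integrable_diff i)
        fix z
        show "f (fst z) - f (snd z) \<le> norm (fst z - snd z)"
          using lipschitz_onD[OF f(1), of "fst z" "snd z"] by (simp add: dist_norm)
      qed
      finally have "ereal (?X / mass M) \<le> enn2ereal (ennreal (\<integral>z. norm (fst z - snd z) \<partial>\<pi>))"
        by (simp add: enn2ereal_ennreal integral_nonneg)
      also have "ennreal (\<integral>z. norm (fst z - snd z) \<partial>\<pi>) = (\<integral>\<^sup>+ (x, y). ennreal (norm (x - y)) \<partial>\<pi>)"
        using nn_integral_eq_integral[OF id] by (simp add: split_beta')
      finally show ?thesis .
    qed
    then have "ereal (?X / mass M) \<le>
        (INF \<pi>\<in>couplings M N. enn2ereal (\<integral>\<^sup>+ (x, y). ennreal (norm (x - y)) \<partial>\<pi>))"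
      by (rule INF_greatest)
    then have "ereal (mass M) * ereal (?X / mass M) \<le> ereal (mass M) *
        (INF \<pi>\<in>couplings M N. enn2ereal (\<integral>\<^sup>+ (x, y). ennreal (norm (x - y)) \<partial>\<pi>))"
      using m by (intro ereal_mult_left_mono) auto
    also have "\<dots> = wasserstein1 M N" using False by (simp add: wasserstein1_def)
    finally have "ereal (mass M) * ereal (?X / mass M) \<le> wasserstein1 M N" .
    then show ?thesis using m by simp
  qed
qed

section \<open>The flat metric as a lower bound\<close>

text \<open>Pass from \<open>M\<close> to \<open>M'\<close>, then to \<open>N'\<close>, then to
  \<open>N\<close>: the outer changes of the integral are bounded by the total variations, the
  middle one by the transport cost.\<close>

lemma flat_dist_le_gen_wasserstein:
  fixes M N :: "'a::euclidean_space measure"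
  assumes M: "M \<in> fin_meas" and N: "N \<in> fin_meas"
  shows "flat_dist M N \<le> gen_wasserstein M N"
  unfolding flat_dist_def gen_wasserstein_def
proof (intro SUP_least INF_greatest, clarsimp simp: sup_norm_le_1_iff lip_const_le_1_iff)
  fix f :: "'a \<Rightarrow> real" and M' N' :: "'a measure"
  assume f: "\<forall>x. \<bar>f x\<bar> \<le> 1" "1-lipschitz_on UNIV f" and M': "M' \<in> fin_meas" and N': "N' \<in> fin_meas"
    and m: "mass M' = mass N'"
  have fm: "f \<in> borel_measurable borel"
    using lipschitz_on_continuous_on[OF f(2)] by (rule borel_measurable_continuous_onI)
  have f1: "\<And>x. \<bar>f x\<bar> \<le> 1" using f(1) by blast
  have "(\<integral>x. f x \<partial>M) - (\<integral>x. f x \<partial>N) \<le> total_variation (meas_diff M M') +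
      total_variation (meas_diff N N') + ((\<integral>x. f x \<partial>M') - (\<integral>x. f x \<partial>N'))"
    using integral_diff_le_total_variation[OF M M' fm f1]
      integral_diff_le_total_variation[OF N N' fm f1] by linarith
  then have "ereal ((\<integral>x. f x \<partial>M) - (\<integral>x. f x \<partial>N)) \<le> ereal (total_variation (meas_diff M M') +
      total_variation (meas_diff N N')) + ereal ((\<integral>x. f x \<partial>M') - (\<integral>x. f x \<partial>N'))"
    by simp
  also have "\<dots> \<le> ereal (total_variation (meas_diff M M') +
      total_variation (meas_diff N N')) + wasserstein1 M' N'"
    using integral_diff_le_wasserstein1[OF M' N' m f(2) f1] by (intro add_left_mono)
  finally show "ereal ((\<integral>x. f x \<partial>M) - (\<integral>x. f x \<partial>N)) \<le> ereal (total_variation (meas_diff M M') +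
      total_variation (meas_diff N N')) + wasserstein1 M' N'" .
qed

section \<open>Discretization\<close>

lemma nn_integral_finite_range:
  fixes T :: "'a \<Rightarrow> 'b" and q :: "'b \<Rightarrow> ennreal"
  assumes S: "finite S" "range T \<subseteq> S"
    and K: "\<And>i. i \<in> S \<Longrightarrow> K \<inter> T -` {i} \<in> sets M"
  shows "(\<integral>\<^sup>+x. indicator K x * q (T x) \<partial>M) = (\<Sum>i\<in>S. q i * emeasure M (K \<inter> T -` {i}))"
proof -
  have "indicator K x * q (T x) = (\<Sum>i\<in>S. q i * indicator (K \<inter> T -` {i}) x)" for x
  proof -
    have "(\<Sum>i\<in>S. q i * indicator (K \<inter> T -` {i}) x) = (\<Sum>i\<in>S. if i = T x then indicator K x * q i else 0)"
      by (intro sum.cong) (auto simp: indicator_def)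
    also have "\<dots> = indicator K x * q (T x)" using S by auto
    finally show ?thesis by simp
  qed
  then have "(\<integral>\<^sup>+x. indicator K x * q (T x) \<partial>M) = (\<integral>\<^sup>+x. (\<Sum>i\<in>S. q i * indicator (K \<inter> T -` {i}) x) \<partial>M)"
    by simp
  also have "\<dots> = (\<Sum>i\<in>S. q i * emeasure M (K \<inter> T -` {i}))"
    using K by (subst nn_integral_sum) (auto simp: nn_integral_cmult_indicator)
  finally show ?thesis .
qed

lemma integral_finite_range:
  fixes T :: "'a \<Rightarrow> 'b" and q :: "'b \<Rightarrow> real"
  assumes M: "finite_measure M" and S: "finite S" "range T \<subseteq> S"
    and K: "\<And>i. i \<in> S \<Longrightarrow> K \<inter> T -` {i} \<in> sets M"
  shows "integrable M (\<lambda>x. indicator K x * q (T x))"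
    and "(\<integral>x. indicator K x * q (T x) \<partial>M) = (\<Sum>i\<in>S. q i * measure M (K \<inter> T -` {i}))"
proof -
  interpret finite_measure M by fact
  have *: "(\<lambda>x. indicator K x * q (T x)) = (\<lambda>x. \<Sum>i\<in>S. q i * indicator (K \<inter> T -` {i}) x)"
  proof
    fix x
    have "(\<Sum>i\<in>S. q i * indicator (K \<inter> T -` {i}) x) = (\<Sum>i\<in>S. if i = T x then indicator K x * q i else 0)"
      by (intro sum.cong) (auto simp: indicator_def)
    also have "\<dots> = indicator K x * q (T x)" using S by auto
    finally show "indicator K x * q (T x) = (\<Sum>i\<in>S. q i * indicator (K \<inter> T -` {i}) x)" by simp
  qed
  have i: "integrable M (\<lambda>x. q i * indicator (K \<inter> T -` {i}) x)" if "i \<in> S" for i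
    using K[OF that] by (intro integrable_mult_right) (auto simp: less_top[symmetric])
  show "integrable M (\<lambda>x. indicator K x * q (T x))"
    unfolding * using i by (intro Bochner_Integration.integrable_sum)
  have "(\<integral>x. indicator K x * q (T x) \<partial>M) = (\<Sum>i\<in>S. \<integral>x. q i * indicator (K \<inter> T -` {i}) x \<partial>M)"
    unfolding * using i by (intro Bochner_Integration.integral_sum)
  also have "\<dots> = (\<Sum>i\<in>S. q i * measure M (K \<inter> T -` {i}))"
  proof (intro sum.cong refl)
    fix i assume "i \<in> S"
    then have "K \<inter> T -` {i} \<subseteq> space M" using K sets.sets_into_space by blast
    then show "(\<integral>x. q i * indicator (K \<inter> T -` {i}) x \<partial>M) = q i * measure M (K \<inter> T -` {i})"
      by (simp add: Int_absorb2)
  qed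
  finally show "(\<integral>x. indicator K x * q (T x) \<partial>M) = (\<Sum>i\<in>S. q i * measure M (K \<inter> T -` {i}))" .
qed

text \<open>The identity is a pointwise limit of simple functions. On a finite measure space
  dominated convergence shows that the set where the \<open>n\<close>-th one is off by more than
  \<open>\<epsilon>\<close> has measure tending to zero, so a late index serves both measures at
  once.\<close>

lemma finite_range_approximation:
  fixes M N :: "'a::euclidean_space measure"
  assumes M: "M \<in> fin_meas" and N: "N \<in> fin_meas" and \<epsilon>: "0 < \<epsilon>"
  obtains T :: "'a \<Rightarrow> 'a" and K where "T \<in> measurable borel borel" "finite (range T)" "K \<in> sets borel"
    "\<And>x. x \<in> K \<Longrightarrow> dist x (T x) \<le> \<epsilon>" "measure M (- K) \<le> \<epsilon>" "measure N (- K) \<le> \<epsilon>"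
proof -
  obtain F :: "nat \<Rightarrow> 'a \<Rightarrow> 'a" where F: "\<And>n. simple_function borel (F n)" "\<And>x. (\<lambda>n. F n x) \<longlonglongrightarrow> x"
    using borel_measurable_implies_sequence_metric[of "\<lambda>x::'a. x" borel] by auto metis
  define K where "K n = {x. dist x (F n x) \<le> \<epsilon>}" for n
  have Fm[measurable]: "F n \<in> measurable borel borel" for n
    using F(1) by (rule borel_measurable_simple_function)
  have Km: "K n \<in> sets borel" for n unfolding K_def by measurable
  have lim: "(\<lambda>n. measure L (- K n)) \<longlonglongrightarrow> 0" if L: "L \<in> fin_meas" for L
  proof -
    interpret L: finite_measure L using L by (simp add: fin_meas_iff)
    have sL: "sets L = sets borel" using L by (simp add: fin_meas_iff)
    have spL: "space L = UNIV" using sets_eq_imp_space_eq[OF sL] by simp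
    have "(\<lambda>n. \<integral>x. indicator (- K n) x \<partial>L) \<longlonglongrightarrow> (\<integral>x. (0::real) \<partial>L)"
    proof (rule integral_dominated_convergence[where w="\<lambda>_. 1"])
      show "(\<lambda>x. indicator (- K n) x :: real) \<in> borel_measurable L" for n
        using Km[of n] sL by (intro borel_measurable_indicator) (auto simp: sL)
      have "(\<lambda>n. indicator (- K n) x :: real) \<longlonglongrightarrow> 0" for x
      proof -
        have "eventually (\<lambda>n. dist (F n x) x < \<epsilon>) sequentially"
          using F(2) \<epsilon> by (rule tendstoD)
        then have "eventually (\<lambda>n. (indicator (- K n) x :: real) = 0) sequentially"
          by eventually_elim (simp add: K_def dist_commute)
        then show ?thesis by (rule tendsto_eventually)
      qed
      then show "AE x in L. (\<lambda>n. indicator (- K n) x :: real) \<longlonglongrightarrow> 0" by simp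
    qed (auto simp: indicator_def)
    then show ?thesis by (simp add: spL)
  qed
  have "eventually (\<lambda>n. measure M (- K n) < \<epsilon>) sequentially"
    "eventually (\<lambda>n. measure N (- K n) < \<epsilon>) sequentially"
    using order_tendstoD(2)[OF lim[OF M] \<epsilon>] order_tendstoD(2)[OF lim[OF N] \<epsilon>] by auto
  then have "eventually (\<lambda>n. measure M (- K n) < \<epsilon> \<and> measure N (- K n) < \<epsilon>) sequentially"
    by (rule eventually_conj)
  then obtain n where n: "measure M (- K n) < \<epsilon>" "measure N (- K n) < \<epsilon>"
    using eventually_happens'[OF sequentially_bot] by blast
  have "finite (range (F n))" using simple_functionD(1)[OF F(1)[of n]] by simp
  then show thesis
    using that[OF Fm[of n] _ Km[of n]] n unfolding K_def by auto
qed

section \<open>Test functions from discrete potentials\<close>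

lemma lipschitz_on_min_max:
  fixes f g :: "'a::metric_space \<Rightarrow> real"
  assumes "L-lipschitz_on X f" "L-lipschitz_on X g"
  shows "L-lipschitz_on X (\<lambda>x. min (f x) (g x))" "L-lipschitz_on X (\<lambda>x. max (f x) (g x))"
proof -
  have *: "\<bar>f x - f y\<bar> \<le> L * dist x y" "\<bar>g x - g y\<bar> \<le> L * dist x y" if "x \<in> X" "y \<in> X" for x y
    using lipschitz_onD[OF assms(1) that] lipschitz_onD[OF assms(2) that] by (auto simp: dist_real_def)
  have "\<bar>min (f x) (g x) - min (f y) (g y)\<bar> \<le> L * dist x y"
    "\<bar>max (f x) (g x) - max (f y) (g y)\<bar> \<le> L * dist x y" if "x \<in> X" "y \<in> X" for x y
    using *[OF that] by linarith+
  then show "L-lipschitz_on X (\<lambda>x. min (f x) (g x))" "L-lipschitz_on X (\<lambda>x. max (f x) (g x))"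
    using lipschitz_on_nonneg[OF assms(1)] by (auto simp: lipschitz_on_def dist_real_def)
qed

text \<open>Before the cutoff the function is the minimum of \<open>1\<close> and of all
  \<open>dist x j + (\<delta> - g j)\<close> with \<open>j\<close> in \<open>J\<close>. Each term is
  1-Lipschitz and at least \<open>-1\<close>; the constraint \<open>fg\<close> keeps the minimum
  above \<open>f\<close> on \<open>I\<close>, and the term of \<open>j\<close> keeps it below
  \<open>\<delta> - g j\<close> at \<open>j\<close>.\<close>

lemma lipschitz_test_function:
  fixes S :: "'a::euclidean_space set" and f g :: "'a \<Rightarrow> real"
  assumes S: "finite S" "I \<subseteq> S" "J \<subseteq> S" and \<delta>: "0 \<le> \<delta>"
    and f: "\<And>i. i \<in> I \<Longrightarrow> \<bar>f i\<bar> \<le> 1" and g: "\<And>j. j \<in> J \<Longrightarrow> \<bar>g j\<bar> \<le> 1"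
    and fg: "\<And>i j. i \<in> I \<Longrightarrow> j \<in> J \<Longrightarrow> f i + g j \<le> dist i j + \<delta>"
  obtains F :: "'a \<Rightarrow> real" where "1-lipschitz_on UNIV F" "\<And>x. \<bar>F x\<bar> \<le> 1"
    "compact (closure {x. F x \<noteq> 0})"
    "\<And>i. i \<in> I \<Longrightarrow> f i \<le> F i" "\<And>j. j \<in> J \<Longrightarrow> g j \<le> \<delta> - F j"
proof -
  have fin: "finite J" using S finite_subset by blast
  have "\<exists>G. 1-lipschitz_on UNIV G \<and> (\<forall>x. -1 \<le> G x \<and> G x \<le> 1) \<and>
      (\<forall>i\<in>I. f i \<le> G i) \<and> (\<forall>j\<in>J. g j \<le> \<delta> - G j)"
    using fin g fg
  \<comment> \<open>The minimum is built one term at a time. The constant \<open>1\<close> as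
    starting value covers empty \<open>J\<close> and supplies the upper bound.\<close>
  proof (induction J)
    case empty
    have "1-lipschitz_on UNIV (\<lambda>x::'a. 1::real)" by (auto simp: lipschitz_on_def)
    then show ?case using f by (intro exI[of _ "\<lambda>_. 1"]) (auto simp: abs_le_iff)
  next
    case (insert j J)
    then obtain G where G: "1-lipschitz_on UNIV G" "\<And>x. -1 \<le> G x \<and> G x \<le> 1"
      "\<And>i. i \<in> I \<Longrightarrow> f i \<le> G i" "\<And>j. j \<in> J \<Longrightarrow> g j \<le> \<delta> - G j" by blast
    define H where "H x = dist x j + (\<delta> - g j)" for x
    have "1-lipschitz_on UNIV H"
      unfolding lipschitz_on_def H_def dist_real_def
    proof (intro conjI ballI)
      fix x y :: 'a
      show "\<bar>dist x j + (\<delta> - g j) - (dist y j + (\<delta> - g j))\<bar> \<le> 1 * dist x y"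
        using dist_triangle[of x j y] dist_triangle[of y j x] by (simp add: dist_commute abs_le_iff)
    qed simp
    with G(1) have L: "1-lipschitz_on UNIV (\<lambda>x. min (G x) (H x))" by (rule lipschitz_on_min_max)
    have gj: "\<bar>g j\<bar> \<le> 1" using insert.prems(1) by simp
    have "-1 \<le> H x" for x
      using gj \<delta> zero_le_dist[of x j] unfolding H_def by linarith
    then have "-1 \<le> min (G x) (H x) \<and> min (G x) (H x) \<le> 1" for x
      using G(2)[of x] by auto
    moreover have "f i \<le> min (G i) (H i)" if "i \<in> I" for i
      using G(3)[OF that] insert.prems(2)[of i j] that by (simp add: H_def)
    moreover have "g j' \<le> \<delta> - min (G j') (H j')" if "j' \<in> insert j J" for j'
    proof (cases "j' = j")
      case True
      have "min (G j) (H j) \<le> \<delta> - g j" by (simp add: H_def)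
      then show ?thesis unfolding True by linarith
    next
      case False
      then have "g j' \<le> \<delta> - G j'" using G(4) that by simp
      then show ?thesis by linarith
    qed
    ultimately show ?case using L by (intro exI[of _ "\<lambda>x. min (G x) (H x)"]) blast
  qed
  then obtain G where *: "1-lipschitz_on UNIV G \<and> (\<forall>x. -1 \<le> G x \<and> G x \<le> 1) \<and>
      (\<forall>i\<in>I. f i \<le> G i) \<and> (\<forall>j\<in>J. g j \<le> \<delta> - G j)" ..
  then have G: "1-lipschitz_on UNIV G" "\<And>x. -1 \<le> G x \<and> G x \<le> 1"
    "\<And>i. i \<in> I \<Longrightarrow> f i \<le> G i" "\<And>j. j \<in> J \<Longrightarrow> g j \<le> \<delta> - G j" by simp_all
  obtain R where R: "\<And>x. x \<in> S \<Longrightarrow> norm x \<le> R"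
    using finite_imp_bounded[OF S(1)] unfolding bounded_iff by blast
  \<comment> \<open>The cutoff is \<open>1\<close> on a ball of radius \<open>R\<close> containing
    \<open>S\<close> and vanishes at norm \<open>R + 1\<close> and beyond, so its slope is at most
    \<open>1\<close>.\<close>
  define \<phi> where "\<phi> x = max 0 (min 1 (R + 1 - norm x))" for x :: 'a
  have c: "1-lipschitz_on UNIV (\<lambda>x::'a. r)" for r :: real by (auto simp: lipschitz_on_def)
  have "1-lipschitz_on UNIV (\<lambda>x::'a. R + 1 - norm x)"
    unfolding lipschitz_on_def dist_real_def
  proof (intro conjI ballI)
    fix x y :: 'a
    show "\<bar>R + 1 - norm x - (R + 1 - norm y)\<bar> \<le> 1 * dist x y"
      using norm_triangle_ineq3[of x y] by (simp add: dist_norm abs_minus_commute)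
  qed simp
  then have \<phi>L: "1-lipschitz_on UNIV \<phi>"
    unfolding \<phi>_def by (intro lipschitz_on_min_max c)
  then have \<phi>L': "1-lipschitz_on UNIV (\<lambda>x. - \<phi> x)" by simp
  \<comment> \<open>Clamping \<open>G\<close> between \<open>- \<phi>\<close> and
    \<open>\<phi>\<close> preserves the Lipschitz constant \<open>1\<close>, which multiplication by
    \<open>\<phi>\<close> could spoil; where \<open>\<phi> = 1\<close> it changes nothing.\<close>
  define F where "F x = max (- \<phi> x) (min (\<phi> x) (G x))" for x
  have \<phi>01: "0 \<le> \<phi> x" "\<phi> x \<le> 1" for x by (auto simp: \<phi>_def)
  have FS: "F x = G x" if "x \<in> S" for x
  proof -
    have "\<phi> x = 1" using R[OF that] by (simp add: \<phi>_def)
    then show ?thesis using G(2)[of x] by (simp add: F_def)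
  qed
  have "1-lipschitz_on UNIV F"
    unfolding F_def by (intro lipschitz_on_min_max \<phi>L \<phi>L' G(1))
  moreover have "\<bar>F x\<bar> \<le> 1" for x using \<phi>01[of x] by (auto simp: F_def)
  moreover have "compact (closure {x. F x \<noteq> 0})"
  proof -
    have "norm x \<le> R + 1" if "F x \<noteq> 0" for x
      using that by (rule contrapos_np) (simp add: F_def \<phi>_def)
    then have "bounded {x. F x \<noteq> 0}" unfolding bounded_iff by blast
    then show ?thesis by simp
  qed
  moreover have "f i \<le> F i" if "i \<in> I" for i using G(3)[OF that] FS S that by auto
  moreover have "g j \<le> \<delta> - F j" if "j \<in> J" for j using G(4)[OF that] FS S that by auto
  ultimately show thesis by (rule that)
qed

section \<open>Densities on products and on fibres\<close>

lemma distr_density_pair_fst: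
  fixes M N :: "'a::euclidean_space measure" and h :: "'a \<times> 'a \<Rightarrow> ennreal"
  assumes M: "M \<in> fin_meas" and N: "N \<in> fin_meas"
    and h: "h \<in> borel_measurable (borel \<Otimes>\<^sub>M borel)"
  shows "distr (density (M \<Otimes>\<^sub>M N) h) borel fst = density M (\<lambda>x. \<integral>\<^sup>+y. h (x, y) \<partial>N)"
proof -
  interpret M: finite_measure M using M by (simp add: fin_meas_iff)
  interpret N: finite_measure N using N by (simp add: fin_meas_iff)
  have s[measurable_cong]: "sets M = sets borel" "sets N = sets borel" using M N by (auto simp: fin_meas_iff)
  note [measurable] = h
  show ?thesis
  proof (rule measure_eqI)
    fix A assume "A \<in> sets (distr (density (M \<Otimes>\<^sub>M N) h) borel fst)"
    then have A[measurable]: "A \<in> sets borel" by simp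
    have sp: "space (M \<Otimes>\<^sub>M N) = UNIV"
      using s[THEN sets_eq_imp_space_eq] by (simp add: space_pair_measure)
    have "emeasure (distr (density (M \<Otimes>\<^sub>M N) h) borel fst) A = emeasure (density (M \<Otimes>\<^sub>M N) h) (fst -` A)"
      by (subst emeasure_distr) (auto simp: sp)
    also have "\<dots> = (\<integral>\<^sup>+z. h z * indicator (fst -` A) z \<partial>(M \<Otimes>\<^sub>M N))"
    proof (rule emeasure_density)
      have "fst -` A \<inter> space (M \<Otimes>\<^sub>M N) \<in> sets (M \<Otimes>\<^sub>M N)" by measurable
      then show "fst -` A \<in> sets (M \<Otimes>\<^sub>M N)" by (simp add: sp)
    qed measurable
    also have "\<dots> = (\<integral>\<^sup>+z. h z * indicator A (fst z) \<partial>(M \<Otimes>\<^sub>M N))"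
      by (simp add: indicator_def)
    also have "\<dots> = (\<integral>\<^sup>+x. \<integral>\<^sup>+y. h (x, y) * indicator A x \<partial>N \<partial>M)"
      by (subst N.nn_integral_fst[symmetric]) auto
    also have "\<dots> = (\<integral>\<^sup>+x. (\<integral>\<^sup>+y. h (x, y) \<partial>N) * indicator A x \<partial>M)"
      by (intro nn_integral_cong nn_integral_multc) measurable
    also have "\<dots> = emeasure (density M (\<lambda>x. \<integral>\<^sup>+y. h (x, y) \<partial>N)) A"
      by (subst emeasure_density) auto
    finally show "emeasure (distr (density (M \<Otimes>\<^sub>M N) h) borel fst) A =
        emeasure (density M (\<lambda>x. \<integral>\<^sup>+y. h (x, y) \<partial>N)) A" .
  qed (simp add: s)
qed

lemma distr_density_pair_snd:
  fixes M N :: "'a::euclidean_space measure" and h :: "'a \<times> 'a \<Rightarrow> ennreal"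
  assumes M: "M \<in> fin_meas" and N: "N \<in> fin_meas"
    and h: "h \<in> borel_measurable (borel \<Otimes>\<^sub>M borel)"
  shows "distr (density (M \<Otimes>\<^sub>M N) h) borel snd = density N (\<lambda>y. \<integral>\<^sup>+x. h (x, y) \<partial>M)"
proof -
  interpret M: finite_measure M using M by (simp add: fin_meas_iff)
  interpret N: finite_measure N using N by (simp add: fin_meas_iff)
  interpret pair_sigma_finite M N ..
  have s[measurable_cong]: "sets M = sets borel" "sets N = sets borel" using M N by (auto simp: fin_meas_iff)
  note [measurable] = h
  \<comment> \<open>Swapping the coordinates turns the second marginal into a first one.\<close>
  have "density (M \<Otimes>\<^sub>M N) h = distr (density (N \<Otimes>\<^sub>M M) (\<lambda>(y, x). h (x, y))) (M \<Otimes>\<^sub>M N) (\<lambda>(y, x). (x, y))"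
    by (subst distr_pair_swap) (simp add: density_distr split_beta')
  then have "distr (density (M \<Otimes>\<^sub>M N) h) borel snd = distr (density (N \<Otimes>\<^sub>M M) (\<lambda>(y, x). h (x, y))) borel fst"
    by (simp add: distr_distr comp_def split_beta')
  also have "\<dots> = density N (\<lambda>y. \<integral>\<^sup>+x. h (x, y) \<partial>M)"
    by (subst distr_density_pair_fst[OF N M]) auto
  finally show ?thesis .
qed

lemma finite_range_simple_function:
  fixes U :: "'a \<Rightarrow> 'b::t1_space"
  assumes U: "U \<in> measurable M borel" "finite (range U)"
  shows "simple_function M U"
  unfolding simple_function_def
proof (intro conjI ballI)
  show "finite (U ` space M)" using U(2) by (rule rev_finite_subset) auto
  show "U -` {x} \<inter> space M \<in> sets M" for x using U(1) by (rule measurable_sets) simp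
qed

text \<open>Measurability holds for arbitrary \<open>q\<close> because \<open>q\<close> is evaluated
  at finitely many pairs only, which makes the composite a simple function.\<close>

lemma finite_range_pair_measurable:
  fixes T :: "'a::euclidean_space \<Rightarrow> 'a" and q :: "'a \<Rightarrow> 'a \<Rightarrow> 'c::topological_space"
  assumes T: "T \<in> measurable borel borel" "finite (range T)"
  shows "(\<lambda>z. q (T (fst z)) (T (snd z))) \<in> borel_measurable (borel \<Otimes>\<^sub>M borel)"
proof -
  have [measurable]: "T \<in> measurable borel borel" by fact
  have "finite (range (\<lambda>z::'a \<times> 'a. T (fst z)))" "finite (range (\<lambda>z::'a \<times> 'a. T (snd z)))"
    using T(2) by (auto intro: rev_finite_subset)
  then have "simple_function (borel \<Otimes>\<^sub>M borel) (\<lambda>z. q (T (fst z)) (T (snd z)))"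
    by (intro simple_function_compose2[of _ _ _ q] finite_range_simple_function) simp_all
  then show ?thesis by (rule borel_measurable_simple_function)
qed

lemma finite_range_fibre:
  fixes T :: "'a::euclidean_space \<Rightarrow> 'a"
  assumes "T \<in> measurable borel borel" "K \<in> sets borel"
  shows "K \<inter> T -` {i} \<in> sets borel"
  using assms(2) measurable_sets[OF assms(1), of "{i}"] by auto

lemma nn_integral_finite_range_pair:
  fixes M N :: "'a::euclidean_space measure" and q :: "'a \<Rightarrow> 'a \<Rightarrow> ennreal"
  assumes M: "M \<in> fin_meas" and N: "N \<in> fin_meas"
    and T: "T \<in> measurable borel borel" "finite (range T)" and K: "K \<in> sets borel"
  shows "(\<integral>\<^sup>+z. indicator K (fst z) * indicator K (snd z) * q (T (fst z)) (T (snd z)) \<partial>(M \<Otimes>\<^sub>M N)) =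
    (\<Sum>i\<in>range T. \<Sum>j\<in>range T. q i j * emeasure N (K \<inter> T -` {j}) * emeasure M (K \<inter> T -` {i}))"
proof -
  interpret N: finite_measure N using N by (simp add: fin_meas_iff)
  have s[measurable_cong]: "sets M = sets borel" "sets N = sets borel" using M N by (auto simp: fin_meas_iff)
  note [measurable] = K
  have [measurable]: "(\<lambda>z. q (T (fst z)) (T (snd z))) \<in> borel_measurable (borel \<Otimes>\<^sub>M borel)"
    by (rule finite_range_pair_measurable[OF T])
  have fib: "K \<inter> T -` {i} \<in> sets M" "K \<inter> T -` {i} \<in> sets N" for i
    using finite_range_fibre[OF T(1) K] s by auto
  have "(\<integral>\<^sup>+z. indicator K (fst z) * indicator K (snd z) * q (T (fst z)) (T (snd z)) \<partial>(M \<Otimes>\<^sub>M N)) =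
      (\<integral>\<^sup>+x. \<integral>\<^sup>+y. indicator K x * indicator K y * q (T x) (T y) \<partial>N \<partial>M)"
    by (subst N.nn_integral_fst[symmetric]) auto
  also have "\<dots> = (\<integral>\<^sup>+x. indicator K x * (\<Sum>j\<in>range T. q (T x) j * emeasure N (K \<inter> T -` {j})) \<partial>M)"
  proof (intro nn_integral_cong)
    fix x
    have "(\<integral>\<^sup>+y. indicator K x * indicator K y * q (T x) (T y) \<partial>N) =
        (\<integral>\<^sup>+y. indicator K y * (indicator K x * q (T x) (T y)) \<partial>N)"
      by (simp add: ac_simps)
    also have "\<dots> = (\<Sum>j\<in>range T. indicator K x * q (T x) j * emeasure N (K \<inter> T -` {j}))"
      using T(2) fib by (intro nn_integral_finite_range) auto
    finally show "(\<integral>\<^sup>+y. indicator K x * indicator K y * q (T x) (T y) \<partial>N) =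
        indicator K x * (\<Sum>j\<in>range T. q (T x) j * emeasure N (K \<inter> T -` {j}))"
      by (simp add: sum_distrib_left mult.assoc)
  qed
  also have "\<dots> = (\<Sum>i\<in>range T. (\<Sum>j\<in>range T. q i j * emeasure N (K \<inter> T -` {j})) * emeasure M (K \<inter> T -` {i}))"
    using T(2) fib by (intro nn_integral_finite_range) auto
  finally show ?thesis by (simp add: sum_distrib_right)
qed

text \<open>The density \<open>r i / a i\<close> changes the mass of the fibre over \<open>i\<close>
  from \<open>a i\<close> to \<open>r i\<close> proportionally, at a variation of
  \<open>\<bar>a i - r i\<bar>\<close>. Everything outside \<open>K\<close> is deleted, and fibres
  with \<open>a i = 0\<close> contribute nothing to the integral.\<close>

lemma total_variation_rescale_fibres:
  fixes M :: "'a::euclidean_space measure" and r :: "'a \<Rightarrow> real"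
  assumes M: "M \<in> fin_meas" and T: "T \<in> measurable borel borel" "finite (range T)" and K: "K \<in> sets borel"
    and r: "\<And>i. 0 \<le> r i"
  defines "a \<equiv> \<lambda>i. measure M (K \<inter> T -` {i})"
  defines "D \<equiv> density M (\<lambda>x. ennreal (indicator K x * (r (T x) / a (T x))))"
  shows "D \<in> fin_meas"
    and "total_variation (meas_diff M D) \<le>
      measure M (- K) + (\<Sum>i\<in>{i\<in>range T. a i \<noteq> 0}. \<bar>a i - r i\<bar>)"
proof -
  interpret M: finite_measure M using M by (simp add: fin_meas_iff)
  have sM: "sets M = sets borel" using M by (auto simp: fin_meas_iff)
  have fib: "K \<inter> T -` {i} \<in> sets M" for i
    using finite_range_fibre[OF T(1) K] sM by auto
  note int = integral_finite_range[OF M.finite_measure_axioms T(2) subset_refl fib]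
  define k where "k x = indicator K x * (r (T x) / a (T x))" for x
  have "(\<lambda>x. r (T x) / a (T x)) \<in> borel_measurable borel"
    using simple_function_compose1[OF finite_range_simple_function[OF T], of "\<lambda>i. r i / a i"]
    by (rule borel_measurable_simple_function)
  then have k: "k \<in> borel_measurable borel" unfolding k_def using K by measurable
  have k0: "0 \<le> k x" for x using r by (simp add: k_def a_def)
  have ki: "integrable M k" unfolding k_def by (rule int(1))
  show "D \<in> fin_meas"
    using total_variation_density_le(1)[OF M k k0 ki] by (simp add: D_def k_def)
  have "total_variation (meas_diff M D) \<le> (\<integral>x. \<bar>1 - k x\<bar> \<partial>M)"
    using total_variation_density_le(2)[OF M k k0 ki] by (simp add: D_def k_def)
  also have "\<dots> = (\<integral>x. indicator (- K) x + indicator K x * \<bar>1 - r (T x) / a (T x)\<bar> \<partial>M)"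
    by (intro Bochner_Integration.integral_cong) (auto simp: k_def indicator_def)
  also have "\<dots> = (\<integral>x. indicator (- K) x \<partial>M) + (\<integral>x. indicator K x * \<bar>1 - r (T x) / a (T x)\<bar> \<partial>M)"
    using K sM int(1)[of "\<lambda>i. \<bar>1 - r i / a i\<bar>"]
    by (intro Bochner_Integration.integral_add integrable_real_indicator) (auto simp: less_top[symmetric])
  also have "(\<integral>x. indicator (- K) x \<partial>M) = measure M (- K)"
    using sets_eq_imp_space_eq[OF sM] by simp
  also have "(\<integral>x. indicator K x * \<bar>1 - r (T x) / a (T x)\<bar> \<partial>M) = (\<Sum>i\<in>range T. \<bar>1 - r i / a i\<bar> * a i)"
    using int(2)[of "\<lambda>i. \<bar>1 - r i / a i\<bar>"] by (simp add: a_def)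
  also have "\<dots> = (\<Sum>i\<in>{i\<in>range T. a i \<noteq> 0}. \<bar>1 - r i / a i\<bar> * a i)"
    using T(2) by (intro sum.mono_neutral_right) auto
  also have "\<dots> = (\<Sum>i\<in>{i\<in>range T. a i \<noteq> 0}. \<bar>a i - r i\<bar>)"
  proof (intro sum.cong refl)
    fix i assume "i \<in> {i\<in>range T. a i \<noteq> 0}"
    then have "a i > 0" using measure_nonneg[of M "K \<inter> T -` {i}"] by (auto simp: a_def less_le)
    then have "\<bar>1 - r i / a i\<bar> * a i = \<bar>(1 - r i / a i) * a i\<bar>" by (simp add: abs_mult)
    also have "(1 - r i / a i) * a i = a i - r i" using \<open>a i > 0\<close> by (simp add: field_simps)
    finally show "\<bar>1 - r i / a i\<bar> * a i = \<bar>a i - r i\<bar>" .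
  qed
  finally show "total_variation (meas_diff M D) \<le>
      measure M (- K) + (\<Sum>i\<in>{i\<in>range T. a i \<noteq> 0}. \<bar>a i - r i\<bar>)" .
qed

text \<open>On \<open>K\<close> rounding changes \<open>H\<close> by at most
  \<open>\<epsilon>\<close>; off \<open>K\<close> the integrand is replaced by \<open>0\<close>,
  which is at most \<open>H x + 1\<close>. The one-sided bound serves both signs, being applied to a
  test function for one measure and to its negative for the other.\<close>

lemma sum_fibres_le_integral:
  fixes M :: "'a::euclidean_space measure" and H :: "'a \<Rightarrow> real"
  assumes M: "M \<in> fin_meas" and T: "T \<in> measurable borel borel" "finite (range T)" and K: "K \<in> sets borel"
    and d: "\<And>x. x \<in> K \<Longrightarrow> dist x (T x) \<le> \<epsilon>" and \<epsilon>: "0 \<le> \<epsilon>"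
    and H: "1-lipschitz_on UNIV H" "\<And>x. \<bar>H x\<bar> \<le> 1"
  shows "(\<Sum>i\<in>range T. H i * measure M (K \<inter> T -` {i})) \<le> (\<integral>x. H x \<partial>M) + \<epsilon> * mass M + measure M (- K)"
proof -
  interpret M: finite_measure M using M by (simp add: fin_meas_iff)
  have sM: "sets M = sets borel" using M by (auto simp: fin_meas_iff)
  have spM: "space M = UNIV" using sets_eq_imp_space_eq[OF sM] by simp
  have fib: "K \<inter> T -` {i} \<in> sets M" for i
    using finite_range_fibre[OF T(1) K] sM by auto
  note int = integral_finite_range[OF M.finite_measure_axioms T(2) subset_refl fib]
  have "H \<in> borel_measurable borel"
    using lipschitz_on_continuous_on[OF H(1)] by (rule borel_measurable_continuous_onI)
  then have Hi: "integrable M H" using H(2) by (rule fin_meas_integrable_bounded[OF M])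
  have Ki: "integrable M (indicator (- K) :: 'a \<Rightarrow> real)"
    using K sM by (intro integrable_real_indicator) (auto simp: less_top[symmetric])
  have "(\<Sum>i\<in>range T. H i * measure M (K \<inter> T -` {i})) = (\<integral>x. indicator K x * H (T x) \<partial>M)"
    using int(2) by simp
  also have "\<dots> \<le> (\<integral>x. (H x + \<epsilon>) + indicator (- K) x \<partial>M)"
  proof (intro integral_mono int(1))
    show "integrable M (\<lambda>x. (H x + \<epsilon>) + indicator (- K) x)" using Hi Ki by auto
    fix x
    show "indicator K x * H (T x) \<le> (H x + \<epsilon>) + indicator (- K) x"
    proof (cases "x \<in> K")
      case True
      then show ?thesis
        using lipschitz_onD[OF H(1), of "T x" x] d[of x]
        by (simp add: dist_real_def dist_commute abs_le_iff)
    next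
      case False
      then show ?thesis using H(2)[of x] \<epsilon> by (simp add: abs_le_iff)
    qed
  qed
  also have "\<dots> = (\<integral>x. H x \<partial>M) + \<epsilon> * mass M + measure M (- K)"
    using Hi Ki by (simp add: spM mass_def)
  finally show ?thesis .
qed

section \<open>The upper bound\<close>

text \<open>The constant counts errors in units of \<open>\<epsilon>\<close>. The \<open>5\<close>
  collects the mass outside \<open>K\<close>, entering twice through the variations and twice
  through the integrals, and the near-optimality of the plan. Rounding costs
  \<open>mass M + mass N\<close>, and the slack in the cost function adds
  \<open>2 * mass N\<close>.\<close>

lemma gen_wasserstein_le_flat_dist_add:
  fixes M N :: "'a::euclidean_space measure"
  assumes M: "M \<in> fin_meas" and N: "N \<in> fin_meas" and \<epsilon>: "0 < \<epsilon>"
  shows "gen_wasserstein M N \<le> flat_dist M N + ereal (\<epsilon> * (5 + mass M + 3 * mass N))"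
proof -
  interpret M: finite_measure M using M by (simp add: fin_meas_iff)
  interpret N: finite_measure N using N by (simp add: fin_meas_iff)
  have s[measurable_cong]: "sets M = sets borel" "sets N = sets borel" using M N by (auto simp: fin_meas_iff)
  obtain T :: "'a \<Rightarrow> 'a" and K where T: "T \<in> measurable borel borel" "finite (range T)" and K: "K \<in> sets borel"
    and d: "\<And>x. x \<in> K \<Longrightarrow> dist x (T x) \<le> \<epsilon>" and MK: "measure M (- K) \<le> \<epsilon>" and NK: "measure N (- K) \<le> \<epsilon>"
    using finite_range_approximation[OF M N \<epsilon>] by blast
  define S where "S = range T"
  define a where "a i = measure M (K \<inter> T -` {i})" for i
  define b where "b i = measure N (K \<inter> T -` {i})" for i
  \<comment> \<open>Only fibres of positive mass enter the finite problem, so the plan can be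
    divided by their masses.\<close>
  define I where "I = {i\<in>S. a i \<noteq> 0}"
  define J where "J = {i\<in>S. b i \<noteq> 0}"
  have S: "finite S" using T(2) by (simp add: S_def)
  have IJ: "I \<subseteq> S" "J \<subseteq> S" "finite I" "finite J" using S by (auto simp: I_def J_def)
  have ab0: "0 \<le> a i" "0 \<le> b i" for i by (auto simp: a_def b_def)
  have fib: "K \<inter> T -` {i} \<in> sets borel" for i by (rule finite_range_fibre[OF T(1) K])
  have em: "emeasure M (K \<inter> T -` {i}) = ennreal (a i)" "emeasure N (K \<inter> T -` {i}) = ennreal (b i)" for i
    by (simp_all add: a_def b_def M.emeasure_eq_measure N.emeasure_eq_measure)
  \<comment> \<open>The slack \<open>2 * \<epsilon>\<close> makes \<open>c (T x) (T y)\<close> an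
    upper bound for \<open>dist x y\<close> when \<open>x\<close> and \<open>y\<close> lie in
    \<open>K\<close>: each endpoint is rounded by at most \<open>\<epsilon>\<close>.\<close>
  define c :: "'a \<Rightarrow> 'a \<Rightarrow> real" where "c i j = dist i j + 2 * \<epsilon>" for i j
  have c0: "0 \<le> c i j" for i j using \<epsilon> by (simp add: c_def)
  obtain p f g where p: "\<And>i j. 0 \<le> p i j"
    and f: "\<And>i. i \<in> I \<Longrightarrow> \<bar>f i\<bar> \<le> 1" and g: "\<And>j. j \<in> J \<Longrightarrow> \<bar>g j\<bar> \<le> 1"
    and fg: "\<And>i j. i \<in> I \<Longrightarrow> j \<in> J \<Longrightarrow> f i + g j \<le> c i j"
    and opt: "(\<Sum>i\<in>I. \<bar>a i - (\<Sum>j\<in>J. p i j)\<bar>) + (\<Sum>j\<in>J. \<bar>b j - (\<Sum>i\<in>I. p i j)\<bar>)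
       + (\<Sum>i\<in>I. \<Sum>j\<in>J. p i j * c i j)
     \<le> (\<Sum>i\<in>I. f i * a i) + (\<Sum>j\<in>J. g j * b j) + \<epsilon>"
    using finite_unbalanced_transport_duality[where a=a and b=b and c=c, OF IJ(3,4) c0 \<epsilon>] by blast
  define row where "row i = (\<Sum>j\<in>J. p i j)" for i
  define col where "col j = (\<Sum>i\<in>I. p i j)" for j
  have rc0: "0 \<le> row i" "0 \<le> col i" for i using p by (auto simp: row_def col_def intro: sum_nonneg)
  \<comment> \<open>On fibres of measure zero the division by zero makes the density vanish, as it should.\<close>
  define q where "q i j = p i j / (a i * b j)" for i j
  have q0: "0 \<le> q i j" for i j using p ab0 by (simp add: q_def)
  define h where "h z = indicator K (fst z) * indicator K (snd z) * ennreal (q (T (fst z)) (T (snd z)))" for z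
  note [measurable] = K
  have [measurable]: "(\<lambda>z. q (T (fst z)) (T (snd z))) \<in> borel_measurable (borel \<Otimes>\<^sub>M borel)"
    by (rule finite_range_pair_measurable[OF T])
  have h[measurable]: "h \<in> borel_measurable (borel \<Otimes>\<^sub>M borel)" unfolding h_def by measurable
  \<comment> \<open>\<open>G\<close> spreads the mass \<open>p i j\<close>, for \<open>i\<close> in
    \<open>I\<close> and \<open>j\<close> in \<open>J\<close>, over the product of the two fibres
    proportionally to the product measure. The measures \<open>M'\<close> and \<open>N'\<close> turn
    out to be its marginals.\<close>
  define G where "G = density (M \<Otimes>\<^sub>M N) h"
  define M' where "M' = density M (\<lambda>x. ennreal (indicator K x * (row (T x) / a (T x))))"
  define N' where "N' = density N (\<lambda>y. ennreal (indicator K y * (col (T y) / b (T y))))"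

  \<comment> \<open>Marginals of the lifted plan\<close>
  have sumJ: "(\<Sum>j\<in>S. q i j * b j) = row i / a i" for i
  proof -
    have "(\<Sum>j\<in>S. q i j * b j) = (\<Sum>j\<in>J. q i j * b j)"
      using S by (intro sum.mono_neutral_right) (auto simp: J_def)
    also have "\<dots> = (\<Sum>j\<in>J. p i j / a i)"
      by (intro sum.cong) (auto simp: q_def J_def)
    finally show ?thesis by (simp add: row_def sum_divide_distrib)
  qed
  have sumI: "(\<Sum>i\<in>S. q i j * a i) = col j / b j" for j
  proof -
    have "(\<Sum>i\<in>S. q i j * a i) = (\<Sum>i\<in>I. q i j * a i)"
      using S by (intro sum.mono_neutral_right) (auto simp: I_def)
    also have "\<dots> = (\<Sum>i\<in>I. p i j / b j)"
      by (intro sum.cong) (auto simp: q_def I_def)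
    finally show ?thesis by (simp add: col_def sum_divide_distrib)
  qed
  have "distr G borel fst = density M (\<lambda>x. \<integral>\<^sup>+y. h (x, y) \<partial>N)"
    unfolding G_def by (rule distr_density_pair_fst[OF M N h])
  also have "(\<lambda>x. \<integral>\<^sup>+y. h (x, y) \<partial>N) = (\<lambda>x. ennreal (indicator K x * (row (T x) / a (T x))))"
  proof
    fix x
    have "(\<integral>\<^sup>+y. h (x, y) \<partial>N) = (\<integral>\<^sup>+y. indicator K y * (indicator K x * ennreal (q (T x) (T y))) \<partial>N)"
      by (simp add: h_def ac_simps)
    also have "\<dots> = (\<Sum>j\<in>S. indicator K x * ennreal (q (T x) j) * emeasure N (K \<inter> T -` {j}))"
      using S fib s by (intro nn_integral_finite_range) (auto simp: S_def)
    also have "\<dots> = indicator K x * (\<Sum>j\<in>S. ennreal (q (T x) j * b j))"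
      using q0 ab0 by (simp add: em ennreal_mult sum_distrib_left mult.assoc)
    also have "\<dots> = ennreal (indicator K x * (row (T x) / a (T x)))"
      using q0 ab0 by (simp add: sum_ennreal sumJ indicator_def)
    finally show "(\<integral>\<^sup>+y. h (x, y) \<partial>N) = ennreal (indicator K x * (row (T x) / a (T x)))" .
  qed
  finally have G1: "distr G borel fst = M'" by (simp add: M'_def)
  have "distr G borel snd = density N (\<lambda>y. \<integral>\<^sup>+x. h (x, y) \<partial>M)"
    unfolding G_def by (rule distr_density_pair_snd[OF M N h])
  also have "(\<lambda>y. \<integral>\<^sup>+x. h (x, y) \<partial>M) = (\<lambda>y. ennreal (indicator K y * (col (T y) / b (T y))))"
  proof
    fix y
    have "(\<integral>\<^sup>+x. h (x, y) \<partial>M) = (\<integral>\<^sup>+x. indicator K x * (indicator K y * ennreal (q (T x) (T y))) \<partial>M)"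
      by (simp add: h_def ac_simps)
    also have "\<dots> = (\<Sum>i\<in>S. indicator K y * ennreal (q i (T y)) * emeasure M (K \<inter> T -` {i}))"
      using S fib s by (intro nn_integral_finite_range) (auto simp: S_def)
    also have "\<dots> = indicator K y * (\<Sum>i\<in>S. ennreal (q i (T y) * a i))"
      using q0 ab0 by (simp add: em ennreal_mult sum_distrib_left mult.assoc)
    also have "\<dots> = ennreal (indicator K y * (col (T y) / b (T y)))"
      using q0 ab0 by (simp add: sum_ennreal sumI indicator_def)
    finally show "(\<integral>\<^sup>+x. h (x, y) \<partial>M) = ennreal (indicator K y * (col (T y) / b (T y)))" .
  qed
  finally have G2: "distr G borel snd = N'" by (simp add: N'_def)

  \<comment> \<open>Variations and equality of masses\<close>
  have M': "M' \<in> fin_meas" "total_variation (meas_diff M M') \<le> measure M (- K) + (\<Sum>i\<in>I. \<bar>a i - row i\<bar>)"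
    using total_variation_rescale_fibres[OF M T K rc0(1)] by (auto simp: M'_def a_def I_def S_def)
  have N': "N' \<in> fin_meas" "total_variation (meas_diff N N') \<le> measure N (- K) + (\<Sum>j\<in>J. \<bar>b j - col j\<bar>)"
    using total_variation_rescale_fibres[OF N T K rc0(2)] by (auto simp: N'_def b_def J_def S_def)
  have sG: "sets G = sets (borel \<Otimes>\<^sub>M borel)"
    unfolding G_def sets_density by (rule sets_pair_measure_cong[OF s])
  have "fst \<in> measurable G borel" "snd \<in> measurable G borel"
    using sG by (simp_all cong: measurable_cong_sets)
  then have "measure (distr G borel fst) UNIV = measure G (space G)"
    "measure (distr G borel snd) UNIV = measure G (space G)"
    by (simp_all add: measure_distr)
  then have mass_eq: "mass M' = mass N'" by (simp add: mass_def G1 G2)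

  \<comment> \<open>Cost of the lifted plan\<close>
  have "(\<integral>\<^sup>+ (x, y). ennreal (norm (x - y)) \<partial>G) =
      (\<integral>\<^sup>+ z. h z * ennreal (dist (fst z) (snd z)) \<partial>(M \<Otimes>\<^sub>M N))"
    unfolding G_def by (subst nn_integral_density) (auto simp: split_beta' dist_norm)
  also have "\<dots> \<le> (\<integral>\<^sup>+ z. indicator K (fst z) * indicator K (snd z) *
      ennreal (q (T (fst z)) (T (snd z)) * c (T (fst z)) (T (snd z))) \<partial>(M \<Otimes>\<^sub>M N))"
  proof (intro nn_integral_mono)
    fix z :: "'a \<times> 'a"
    have "dist (fst z) (snd z) \<le> c (T (fst z)) (T (snd z))" if "fst z \<in> K" "snd z \<in> K"
      using d[OF that(1)] d[OF that(2)] dist_triangle[of "fst z" "snd z" "T (fst z)"]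
        dist_triangle[of "T (fst z)" "snd z" "T (snd z)"]
      by (simp add: c_def dist_commute)
    then show "h z * ennreal (dist (fst z) (snd z)) \<le> indicator K (fst z) * indicator K (snd z) *
        ennreal (q (T (fst z)) (T (snd z)) * c (T (fst z)) (T (snd z)))"
      using q0 by (auto simp: h_def indicator_def ennreal_mult[symmetric] intro!: ennreal_leI mult_left_mono)
  qed
  also have "\<dots> = (\<Sum>i\<in>S. \<Sum>j\<in>S. ennreal (q i j * c i j) * ennreal (b j) * ennreal (a i))"
    using nn_integral_finite_range_pair[OF M N T K, of "\<lambda>i j. ennreal (q i j * c i j)"]
    by (simp add: em S_def)
  also have "\<dots> = ennreal (\<Sum>i\<in>S. \<Sum>j\<in>S. q i j * c i j * b j * a i)"
    using q0 c0 ab0 by (simp add: ennreal_mult[symmetric] sum_ennreal sum_nonneg)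
  also have "(\<Sum>i\<in>S. \<Sum>j\<in>S. q i j * c i j * b j * a i) = (\<Sum>i\<in>I. \<Sum>j\<in>S. q i j * c i j * b j * a i)"
    using S by (intro sum.mono_neutral_right) (auto simp: I_def)
  also have "\<dots> = (\<Sum>i\<in>I. \<Sum>j\<in>J. q i j * c i j * b j * a i)"
    using S by (intro sum.cong sum.mono_neutral_right) (auto simp: J_def)
  also have "\<dots> = (\<Sum>i\<in>I. \<Sum>j\<in>J. p i j * c i j)"
    by (intro sum.cong) (auto simp: q_def I_def J_def)
  finally have cost: "(\<integral>\<^sup>+ (x, y). ennreal (norm (x - y)) \<partial>G) \<le> ennreal (\<Sum>i\<in>I. \<Sum>j\<in>J. p i j * c i j)" .
  have pc0: "0 \<le> (\<Sum>i\<in>I. \<Sum>j\<in>J. p i j * c i j)" using p c0 by (intro sum_nonneg) auto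
  have "wasserstein1 M' N' \<le> enn2ereal (\<integral>\<^sup>+ (x, y). ennreal (norm (x - y)) \<partial>G)"
    using sG unfolding borel_prod by (intro wasserstein1_le_nn_integral[OF M'(1) _ G1 G2])
  also have "\<dots> \<le> enn2ereal (ennreal (\<Sum>i\<in>I. \<Sum>j\<in>J. p i j * c i j))"
    using cost by (simp add: less_eq_ennreal.rep_eq)
  also have "\<dots> = ereal (\<Sum>i\<in>I. \<Sum>j\<in>J. p i j * c i j)"
    using pc0 by (rule enn2ereal_ennreal)
  finally have W: "wasserstein1 M' N' \<le> ereal (\<Sum>i\<in>I. \<Sum>j\<in>J. p i j * c i j)" .

  \<comment> \<open>The test function and its integrals\<close>
  have fg': "f i + g j \<le> dist i j + 2 * \<epsilon>" if "i \<in> I" "j \<in> J" for i j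
    using fg[OF that] by (simp add: c_def)
  have "0 \<le> 2 * \<epsilon>" using \<epsilon> by simp
  then obtain F :: "'a \<Rightarrow> real" where F: "1-lipschitz_on UNIV F" "\<And>x. \<bar>F x\<bar> \<le> 1"
    "compact (closure {x. F x \<noteq> 0})"
    "\<And>i. i \<in> I \<Longrightarrow> f i \<le> F i" "\<And>j. j \<in> J \<Longrightarrow> g j \<le> 2 * \<epsilon> - F j"
    using lipschitz_test_function[where f=f and g=g, OF S IJ(1,2) _ f g fg'] by blast
  have "(\<Sum>i\<in>I. f i * a i) \<le> (\<Sum>i\<in>I. F i * a i)"
    using F(4) ab0 by (intro sum_mono mult_right_mono) auto
  also have "\<dots> = (\<Sum>i\<in>S. F i * a i)"
    using S by (intro sum.mono_neutral_left) (auto simp: I_def)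
  also have "\<dots> \<le> (\<integral>x. F x \<partial>M) + \<epsilon> * mass M + measure M (- K)"
    using sum_fibres_le_integral[OF M T K d _ F(1,2)] \<epsilon> by (simp add: a_def S_def)
  finally have fa: "(\<Sum>i\<in>I. f i * a i) \<le> (\<integral>x. F x \<partial>M) + \<epsilon> * mass M + \<epsilon>" using MK by linarith
  have "(\<Sum>j\<in>J. g j * b j) \<le> (\<Sum>j\<in>J. (2 * \<epsilon> - F j) * b j)"
    using F(5) ab0 by (intro sum_mono mult_right_mono) auto
  also have "\<dots> = (\<Sum>j\<in>S. (2 * \<epsilon> - F j) * b j)"
    using S by (intro sum.mono_neutral_left) (auto simp: J_def)
  \<comment> \<open>Splitting off the slack, which is charged to the whole mass of \<open>N\<close>,
    leaves a sum to which the rounding bound for \<open>- F\<close> applies.\<close>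
  also have "\<dots> = 2 * \<epsilon> * (\<Sum>j\<in>S. 1 * b j) + (\<Sum>j\<in>S. - F j * b j)"
    unfolding sum_distrib_left sum.distrib[symmetric]
    by (intro sum.cong) (simp_all add: algebra_simps)
  also have "\<dots> \<le> 2 * \<epsilon> * mass N + ((\<integral>x. - F x \<partial>N) + \<epsilon> * mass N + measure N (- K))"
  proof (intro add_mono mult_left_mono)
    have "(\<Sum>j\<in>S. 1 * b j) = (\<integral>x. indicator K x * 1 \<partial>N)"
      using integral_finite_range(2)[OF N.finite_measure_axioms S, of T K "\<lambda>_. 1"] fib s
      by (simp add: b_def S_def)
    also have "\<dots> = measure N (K \<inter> space N)" by simp
    also have "\<dots> \<le> mass N"
      using N.bounded_measure[of "K \<inter> space N"] sets_eq_imp_space_eq[OF s(2)] by (simp add: mass_def)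
    finally show "(\<Sum>j\<in>S. 1 * b j) \<le> mass N" .
    show "(\<Sum>j\<in>S. - F j * b j) \<le> (\<integral>x. - F x \<partial>N) + \<epsilon> * mass N + measure N (- K)"
      using sum_fibres_le_integral[OF N T K d, of "\<lambda>x. - F x"] F(1,2) \<epsilon> by (simp add: b_def S_def)
  qed (use \<epsilon> in auto)
  finally have gb: "(\<Sum>j\<in>J. g j * b j) \<le> - (\<integral>x. F x \<partial>N) + 3 * \<epsilon> * mass N + \<epsilon>"
    using NK by (simp add: algebra_simps)

  \<comment> \<open>Collecting the estimates\<close>
  have "gen_wasserstein M N \<le> ereal (total_variation (meas_diff M M')) +
      ereal (total_variation (meas_diff N N')) + wasserstein1 M' N'"
    unfolding gen_wasserstein_def using M'(1) N'(1) mass_eq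
    by (intro INF_lower2[of "(M', N')"]) auto
  also have "\<dots> \<le> ereal (total_variation (meas_diff M M')) +
      ereal (total_variation (meas_diff N N')) + ereal (\<Sum>i\<in>I. \<Sum>j\<in>J. p i j * c i j)"
    using W by (intro add_left_mono)
  also have "\<dots> \<le> ereal (((\<integral>x. F x \<partial>M) - (\<integral>x. F x \<partial>N)) + \<epsilon> * (5 + mass M + 3 * mass N))"
    using M'(2) N'(2) MK NK opt fa gb by (simp add: row_def col_def algebra_simps)
  also have "\<dots> = ereal ((\<integral>x. F x \<partial>M) - (\<integral>x. F x \<partial>N)) + ereal (\<epsilon> * (5 + mass M + 3 * mass N))"
    by simp
  also have "\<dots> \<le> flat_dist M N + ereal (\<epsilon> * (5 + mass M + 3 * mass N))"
    unfolding flat_dist_def using F(1-3) lipschitz_on_continuous_on[OF F(1)]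
    by (intro add_right_mono SUP_upper) (auto simp: sup_norm_le_1_iff lip_const_le_1_iff)
  finally show ?thesis .
qed

lemma gen_wasserstein_eq_flat_dist:
  fixes M N :: "'a::euclidean_space measure"
  assumes M: "M \<in> fin_meas" and N: "N \<in> fin_meas"
  shows "gen_wasserstein M N = flat_dist M N"
proof (rule antisym)
  show "flat_dist M N \<le> gen_wasserstein M N" by (rule flat_dist_le_gen_wasserstein[OF M N])
  show "gen_wasserstein M N \<le> flat_dist M N"
  proof (rule ereal_le_epsilon2)
    fix e :: real assume e: "0 < e"
    let ?C = "5 + mass M + 3 * mass N"
    have C: "0 < ?C" using measure_nonneg[of M UNIV] measure_nonneg[of N UNIV] unfolding mass_def by linarith
    \<comment> \<open>The summand \<open>5\<close> keeps \<open>?C\<close> positive even when both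
      measures vanish, so \<open>e / ?C\<close> is an admissible accuracy.\<close>
    then have "0 < e / ?C" using e by simp
    from gen_wasserstein_le_flat_dist_add[OF M N this]
    show "gen_wasserstein M N \<le> flat_dist M N + ereal e" using C by simp
  qed
qed

theorem theorem13:
  fixes \<mu> \<nu> :: "(real ^ 'd) measure"
  assumes "\<mu> \<in> fin_meas" and "\<nu> \<in> fin_meas"
  shows "gen_wasserstein \<mu> \<nu> = flat_dist \<mu> \<nu>"
  using assms by (rule gen_wasserstein_eq_flat_dist)

end
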